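(* For every integer $n$ and constant integer $\beta$, there exist an $n$-vertex unweighted undirected graph $G=(V,E)$ and a source $s\in V$ such that every 1-edge $(1,\beta)$ FT-ABFS structure $H$ for $G$ with respect to $s$ satisfies: (1) $|E(H)|=\Omega(n^{5/4})$ if $\beta\le 3$; (2) $|E(H)|=\Omega\!\left(n^{1+\frac{1}{2(\beta+3)}}\right)$ if $4\le\beta\le O(\log n)$; (3) $|E(H)|=\Omega(n^{7/6})$ if $\beta\le 5$; (4) $|E(H)|=\Omega(n^{11/10})$ if $\beta\le 9$.
   Context: For a graph $G'$ and vertices $u,v$, $\mathrm{dist}(u,v,G')$ denotes the number of edges on a shortest $u$–$v$ path in $G'$. Given an unweighted undirected graph $G=(V,E)$ and source $s\in V$, a spanning subgraph $H\subseteq G$ is a 1-edge $(\alpha,\beta)$ FT-ABFS structure with respect to $s$ if for every $v\in V$ and every edge $e\in E$, $\mathrm{dist}(s,v,H\setminus\{e\})\le \alpha\cdot\mathrm{dist}(s,v,G\setminus\{e\})+\beta$. *)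

theory Defs
  imports Complex_Main "HOL-Library.Extended_Real"
begin

definition simple_graph :: "'a set \<Rightarrow> 'a set set \<Rightarrow> bool" where
  "simple_graph V E \<longleftrightarrow> finite V \<and> (\<forall>e\<in>E. e \<subseteq> V \<and> card e = 2)"

definition graph_path :: "'a set \<Rightarrow> 'a set set \<Rightarrow> 'a \<Rightarrow> 'a list \<Rightarrow> 'a \<Rightarrow> bool" where
  "graph_path V E u p v \<longleftrightarrow>
     p \<noteq> [] \<and> hd p = u \<and> last p = v \<and> set p \<subseteq> V \<and> distinct p \<and>
     successively (\<lambda>x y. {x, y} \<in> E) p"

(* The infimum over the empty set is \<infinity>, so disconnected vertices are at distance \<infinity>. *)
definition graph_dist :: "'a \<Rightarrow> 'a \<Rightarrow> 'a set \<Rightarrow> 'a set set \<Rightarrow> enat" where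
  "graph_dist u v V E = (INF p \<in> {p. graph_path V E u p v}. enat (length p - 1))"

(* A spanning subgraph has all of V as its vertices, so it is given by its edge set H alone.
   The failing edge ranges over all of E, whether or not it belongs to H.  If v is unreachable
   from s after the failure in the host graph, the bound is \<infinity> and nothing is required of H;
   otherwise v must remain reachable in H - {e}. *)
definition ft_abfs ::
  "real \<Rightarrow> real \<Rightarrow> 'a set \<Rightarrow> 'a set set \<Rightarrow> 'a \<Rightarrow> 'a set set \<Rightarrow> bool" where
  "ft_abfs \<alpha> \<beta> V E s H \<longleftrightarrow>
     H \<subseteq> E \<and>
     (\<forall>v\<in>V. \<forall>e\<in>E.
        ereal_of_enat (graph_dist s v V (H - {e}))
          \<le> ereal \<alpha> * ereal_of_enat (graph_dist s v V (E - {e})) + ereal \<beta>)"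

end

theory Submission
  imports Defs
begin

text \<open>From every vertex of a path starting at the source a private row leads to a terminal, and
  the rows get shorter along the path so that, once the edge behind the \<open>i\<close>-th path vertex fails, every
  terminal but the \<open>i\<close>-th is reached too late to be of use within the additive slack \<open>b\<close>.
  All terminals are attached to many copies of a gadget; then \<open>H\<close> must contain, in every copy and
  from every port, walks that are at most \<open>b\<close> longer than the shortest ones.

  For \<open>b = 2k - 1\<close> the gadget is Woodruff's butterfly graph with \<open>k\<close> levels on \<open>q ^ k\<close> words, where
  a walk of length less than \<open>3k\<close> through the butterfly uses an edge of the unique shortest one, so
  that \<open>q ^ (k + 1)\<close> edges are needed.  With \<open>q ^ k\<close> of order \<open>\<surd>n\<close> this gives \<open>n ^ (1 + 1 / (2k))\<close>, and
  \<open>k = 2, 3, 5\<close> are the cases (1), (3) and (4).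

  The butterfly loses a factor of order \<open>b\<close>, which is too much if \<open>b\<close> grows with \<open>n\<close>.  There a
  greedily chosen graph with few short cycles is used, whose columns are spread along a path of
  length \<open>b\<close> so that a constant fraction of the vertices has degree of order \<open>n ^ (1 / (2 (b + 3)))\<close>;
  if this is bounded, a star suffices.\<close>

subsection \<open>Walks and the transfer to natural numbers\<close>

text \<open>The index \<open>m\<close> is an upper bound on the number of edges.\<close>

inductive walk :: "'a set set \<Rightarrow> nat \<Rightarrow> 'a \<Rightarrow> 'a \<Rightarrow> bool" for E where
  refl [simp]: "walk E m u u"
| step: "walk E m u v \<Longrightarrow> {v, w} \<in> E \<Longrightarrow> walk E (Suc m) u w"

lemma walk_mono_length: "walk E m u v \<Longrightarrow> m \<le> m' \<Longrightarrow> walk E m' u v"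
proof (induction arbitrary: m' rule: walk.induct)
  case (step m u v w)
  then obtain k where k: "m' = Suc k" "m \<le> k" by (cases m') auto
  from walk.step[OF step.IH[OF k(2)] step.hyps(2)] k(1) show ?case by simp
qed simp

lemma walk_mono_edges: "walk E m u v \<Longrightarrow> E \<subseteq> E' \<Longrightarrow> walk E' m u v"
  by (induction rule: walk.induct) (blast intro: walk.intros)+

lemma walk_trans: "walk E k v w \<Longrightarrow> walk E m u v \<Longrightarrow> walk E (m + k) u w"
proof (induction rule: walk.induct)
  case (refl k v)
  then show ?case by (rule walk_mono_length) simp
next
  case (step k v w x)
  from walk.step[OF step.IH[OF step.prems] step.hyps(2)] show ?case by simp
qed

lemma walk_edge: "{u, v} \<in> E \<Longrightarrow> walk E (Suc 0) u v"
  by (rule walk.step[OF walk.refl])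

text \<open>Lower bounds on walk lengths are read off such potentials. As \<open>{x, y}\<close> is
  unordered, the hypothesis bounds the change in both directions.\<close>

lemma walk_potential:
  assumes "walk E m u v"
    and pot: "\<And>x y. {x, y} \<in> E \<Longrightarrow> pot y \<le> Suc (pot x)"
  shows "pot v \<le> pot u + m"
  using assms(1)
proof (induction rule: walk.induct)
  case (step m u v w)
  with pot[OF step.hyps(2)] show ?case by linarith
qed simp

lemma graph_path_imp_walk:
  assumes "graph_path V E u p v"
  shows "walk E (length p - 1) u v"
proof -
  have "p \<noteq> [] \<Longrightarrow> successively (\<lambda>x y. {x, y} \<in> E) p \<Longrightarrow> walk E (length p - 1) (hd p) (last p)"
  proof (induction p rule: rev_induct)
    case (snoc x p)
    show ?case
    proof (cases "p = []")
      case False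
      with snoc.prems have "successively (\<lambda>x y. {x, y} \<in> E) p" and e: "{last p, x} \<in> E"
        by (auto simp: successively_append_iff)
      with False have "walk E (length p - 1) (hd p) (last p)" by (intro snoc.IH)
      from walk.step[OF this e] False show ?thesis by (cases p) auto
    qed simp
  qed simp
  with assms show ?thesis by (auto simp: graph_path_def)
qed

lemma walk_imp_graph_path:
  assumes "walk E m u v" and E: "\<Union>E \<subseteq> V" and "u \<in> V"
  shows "\<exists>p. graph_path V E u p v \<and> length p - 1 \<le> m"
  using assms(1,3)
proof (induction rule: walk.induct)
  case (refl m u)
  then show ?case by (intro exI[of _ "[u]"]) (simp add: graph_path_def)
next
  case (step m u v w)
  then obtain p where p: "graph_path V E u p v" "length p - 1 \<le> m" by auto
  have w: "w \<in> V" using step.hyps E by auto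
  show ?case
  proof (cases "w \<in> set p")
    case False
    with p step.hyps w show ?thesis
      by (intro exI[of _ "p @ [w]"]) (auto simp: graph_path_def successively_append_iff)
  next
    case True
    \<comment> \<open>A walk that returns to a vertex of \<open>p\<close> is cut back to the prefix
      ending there, which keeps the vertices distinct.\<close>
    then obtain xs ys where xs: "p = xs @ w # ys" by (auto simp: in_set_conv_decomp)
    with p have "graph_path V E u (xs @ [w]) w"
      by (auto simp: graph_path_def successively_append_iff hd_append)
    moreover have "length (xs @ [w]) - 1 \<le> Suc m" using p xs by simp
    ultimately show ?thesis by blast
  qed
qed

lemma graph_dist_le_iff_walk:
  assumes "\<Union>E \<subseteq> V" "u \<in> V"
  shows "graph_dist u v V E \<le> enat m \<longleftrightarrow> walk E m u v"
proof
  assume "graph_dist u v V E \<le> enat m"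
  then have "graph_dist u v V E < enat (Suc m)" by (simp add: order_le_less_trans)
  then obtain p where "graph_path V E u p v" "enat (length p - 1) < enat (Suc m)"
    unfolding graph_dist_def by (auto simp: INF_less_iff)
  then show "walk E m u v" using graph_path_imp_walk walk_mono_length by fastforce
next
  assume "walk E m u v"
  with walk_imp_graph_path assms obtain p where "graph_path V E u p v" "length p - 1 \<le> m"
    by metis
  then show "graph_dist u v V E \<le> enat m"
    unfolding graph_dist_def by (intro INF_lower2[of p]) auto
qed

text \<open>The stretch condition, tested against each finite bound \<open>m\<close>: if
  \<open>v\<close> is unreachable in \<open>E - {e}\<close>, no \<open>m\<close> qualifies and
  nothing is demanded, as for an infinite distance.\<close>

definition ft_walk :: "nat \<Rightarrow> 'a set \<Rightarrow> 'a set set \<Rightarrow> 'a \<Rightarrow> 'a set set \<Rightarrow> bool" where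
  "ft_walk b V E s H \<longleftrightarrow> H \<subseteq> E \<and>
     (\<forall>v\<in>V. \<forall>e\<in>E. \<forall>m. walk (E - {e}) m s v \<longrightarrow> walk (H - {e}) (m + b) s v)"

lemma ft_abfs_imp_ft_walk:
  assumes "simple_graph V E" "s \<in> V" "ft_abfs 1 \<beta> V E s H" "\<beta> \<le> real b"
  shows "ft_walk b V E s H"
  unfolding ft_walk_def
proof (intro conjI ballI allI impI)
  show HE: "H \<subseteq> E" using assms by (simp add: ft_abfs_def)
  have sub: "\<Union>E \<subseteq> V" using assms(1) by (auto simp: simple_graph_def)
  fix v e m
  assume v: "v \<in> V" and e: "e \<in> E" and w: "walk (E - {e}) m s v"
  have "\<Union>(E - {e}) \<subseteq> V" "\<Union>(H - {e}) \<subseteq> V" using sub HE by auto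
  note iff = this[THEN graph_dist_le_iff_walk, OF assms(2)]
  have "graph_dist s v V (E - {e}) \<le> enat m" using iff w by blast
  then have "ereal_of_enat (graph_dist s v V (E - {e})) \<le> ereal_of_enat (enat m)"
    by (simp only: ereal_of_enat_le_iff)
  moreover have "ereal_of_enat (graph_dist s v V (H - {e}))
      \<le> ereal 1 * ereal_of_enat (graph_dist s v V (E - {e})) + ereal \<beta>"
    using assms(3) v e by (auto simp: ft_abfs_def)
  ultimately have "ereal_of_enat (graph_dist s v V (H - {e})) \<le> ereal (real m) + ereal (real b)"
    using assms(4) by (smt (verit) add_mono ereal_less_eq(3) ereal_of_enat_simps(1) mult_1 one_ereal_def order_trans)
  then have "ereal_of_enat (graph_dist s v V (H - {e})) \<le> ereal_of_enat (enat (m + b))"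
    by simp
  then show "walk (H - {e}) (m + b) s v"
    using iff by (simp only: ereal_of_enat_le_iff)
qed

section \<open>Transport along an injection\<close>

lemma inj_image_walk:
  assumes "walk H m (f s) y" "H \<subseteq> (`) f ` E" "inj_on f V" "\<Union>E \<subseteq> V" "s \<in> V"
  shows "\<exists>v\<in>V. y = f v \<and> walk {e \<in> E. f ` e \<in> H} m s v"
  using assms(1)
proof (induction m "f s" y rule: walk.induct)
  case (step m y z)
  then obtain v where v: "v \<in> V" "y = f v" "walk {e \<in> E. f ` e \<in> H} m s v" by auto
  from step assms obtain e where e: "e \<in> E" "{y, z} = f ` e" by blast
  with assms have "e \<subseteq> V" by blast
  from e have "f v \<in> f ` e" "z \<in> f ` e" using v by blast+
  with \<open>e \<subseteq> V\<close> v assms(3) obtain w where w: "v \<in> e" "w \<in> e" "z = f w"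
    by (auto simp: inj_on_image_mem_iff)
  have "f ` {v, w} = f ` e" using w e v by simp
  then have "{v, w} = e"
    using inj_on_image_eq_iff[OF assms(3), of "{v, w}" e] \<open>e \<subseteq> V\<close> w v by blast
  with e step.hyps v w have "{v, w} \<in> {e \<in> E. f ` e \<in> H}" by auto
  from walk.step[OF v(3) this] w \<open>e \<subseteq> V\<close> show ?case by blast
qed (use assms in auto)

lemma image_walk: "walk E m u v \<Longrightarrow> walk ((`) f ` E) m (f u) (f v)"
proof (induction rule: walk.induct)
  case (step m u v w)
  then show ?case by (intro walk.step[of _ m _ "f v"]) (auto intro!: image_eqI[of _ _ "{v, w}"])
qed simp

text \<open>The vertices outside the image of \<open>V\<close> are isolated; being unreachable in the host graph, they
  impose nothing on \<open>H\<close>.\<close>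

lemma transfer_lower_bound:
  fixes V :: "'a set"
  assumes G: "simple_graph V E" "s \<in> V" and card: "card V \<le> n" and \<beta>: "\<beta> \<le> real b"
    and bound: "\<And>H. ft_walk b V E s H \<Longrightarrow> K \<le> card H"
  shows "\<exists>(V'::nat set) E' s'. simple_graph V' E' \<and> card V' = n \<and> s' \<in> V' \<and>
           (\<forall>H. ft_abfs 1 \<beta> V' E' s' H \<longrightarrow> K \<le> card H)"
proof -
  have fin: "finite V" and sub: "\<Union>E \<subseteq> V" using G by (auto simp: simple_graph_def)
  obtain f where f: "inj_on f V" "f ` V \<subseteq> {..<n}"
    using card_le_inj[of V "{..<n}"] fin card by auto
  define E' where "E' = (`) f ` E"
  have inj: "inj_on ((`) f) E"
    using sub by (intro inj_on_subset[OF inj_on_image_Pow[OF f(1)]]) auto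
  have G': "simple_graph {..<n} E'"
    unfolding simple_graph_def
  proof (intro conjI ballI)
    fix e assume "e \<in> E'"
    then obtain e0 where e0: "e0 \<in> E" "e = f ` e0" by (auto simp: E'_def)
    then have "e0 \<subseteq> V" "card e0 = 2" using G by (auto simp: simple_graph_def)
    with e0 f show "e \<subseteq> {..<n}" "card e = 2"
      using card_image[OF inj_on_subset[OF f(1)], of e0] by auto
  qed simp
  have "K \<le> card H" if H: "ft_abfs 1 \<beta> {..<n} E' (f s) H" for H
  proof -
    have ft: "ft_walk b {..<n} E' (f s) H"
      using ft_abfs_imp_ft_walk[OF G' _ H \<beta>] f G by auto
    then have HE: "H \<subseteq> E'" by (simp add: ft_walk_def)
    \<comment> \<open>The edges whose images are kept; walks in \<open>H\<close> pull back to it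
      because \<open>f\<close> is injective on \<open>V\<close>.\<close>
    define H0 where "H0 = {e \<in> E. f ` e \<in> H}"
    have "ft_walk b V E s H0"
      unfolding ft_walk_def
    proof (intro conjI ballI allI impI)
      show "H0 \<subseteq> E" by (auto simp: H0_def)
      fix v e m
      assume v: "v \<in> V" and e: "e \<in> E" and w: "walk (E - {e}) m s v"
      have "(`) f ` (E - {e}) = E' - {f ` e}"
        using inj_on_image_set_diff[OF inj, of E "{e}"] e by (auto simp: E'_def)
      with image_walk[OF w, of f] have "walk (E' - {f ` e}) m (f s) (f v)" by simp
      moreover have "f v \<in> {..<n}" "f ` e \<in> E'" using f(2) v e by (auto simp: E'_def)
      ultimately have w': "walk (H - {f ` e}) (m + b) (f s) (f v)"
        using ft by (simp add: ft_walk_def)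
      have "H - {f ` e} \<subseteq> (`) f ` E" using HE by (auto simp: E'_def)
      from inj_image_walk[OF w' this f(1) sub G(2)]
      obtain v' where v': "v' \<in> V" "f v = f v'"
        "walk {e' \<in> E. f ` e' \<in> H - {f ` e}} (m + b) s v'" by blast
      then have "v' = v" using f v by (auto dest: inj_onD)
      moreover have "{e' \<in> E. f ` e' \<in> H - {f ` e}} \<subseteq> H0 - {e}" by (auto simp: H0_def)
      ultimately show "walk (H0 - {e}) (m + b) s v"
        using walk_mono_edges[OF v'(3)] by simp
    qed
    then have "K \<le> card H0" by (rule bound)
    also have "finite H" using HE fin sub G'
      by (meson finite_Pow_iff finite_subset finite_lessThan Pow_iff subsetI simple_graph_def)
    then have "card H0 \<le> card H"
      using inj_on_subset[OF inj, of H0] by (intro card_inj_on_le[of "(`) f"]) (auto simp: H0_def)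
    finally show ?thesis .
  qed
  moreover have "f s \<in> {..<n}" using f(2) G(2) by blast
  ultimately show ?thesis using G' card_lessThan by metis
qed

subsection \<open>The skeleton\<close>

text \<open>\<open>R k p\<close> is position \<open>p\<close> of the row leaving the \<open>k\<close>-th path vertex \<open>R k 0\<close>; \<open>C g w\<close> is vertex \<open>w\<close> in
  the \<open>g\<close>-th copy of the gadget.\<close>

datatype 'w skeleton = R nat nat | C nat 'w

text \<open>\<open>depth\<close> bounds the distance from any port from below, and
  \<open>sep i\<close> that from port \<open>i\<close>. Crossing a copy from port \<open>i\<close>
  to another port therefore takes at least \<open>b\<close> edges.\<close>

locale gadget =
  fixes W :: "'w set" and F :: "'w set set" and port :: "nat \<Rightarrow> 'w"
    and depth :: "'w \<Rightarrow> nat" and sep :: "nat \<Rightarrow> 'w \<Rightarrow> nat" and d b :: nat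
  assumes graph: "simple_graph W F"
    and port_mem: "\<And>k. k < d \<Longrightarrow> port k \<in> W"
    and depth_port: "\<And>k. k < d \<Longrightarrow> depth (port k) = 0"
    and depth_step: "\<And>u v. {u, v} \<in> F \<Longrightarrow> depth v \<le> Suc (depth u)"
    and sep_step: "\<And>i u v. i < d \<Longrightarrow> {u, v} \<in> F \<Longrightarrow> sep i v \<le> Suc (sep i u)"
    and sep_self: "\<And>i. i < d \<Longrightarrow> sep i (port i) = 0"
    and sep_port: "\<And>i k. i < d \<Longrightarrow> k < d \<Longrightarrow> k \<noteq> i \<Longrightarrow> b \<le> sep i (port k)"
begin

text \<open>Each row is \<open>b + 2\<close> shorter than the one before it; after the additional
  path edge a gain of \<open>b + 1\<close> remains, just more than the slack.\<close>

definition row_length :: "nat \<Rightarrow> nat" where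
  "row_length k = (d - k) * (b + 2)"

definition skel_V :: "nat \<Rightarrow> 'w skeleton set" where
  "skel_V M = (\<Union>k\<in>{..d}. R k ` {..row_length k}) \<union> (\<Union>g\<in>{..<M}. C g ` W)"

text \<open>The path runs on to \<open>R d 0\<close>, which has no port, so that an edge that can
  fail lies behind every path vertex with a port.\<close>

inductive_set skel_E :: "nat \<Rightarrow> 'w skeleton set set" for M where
  main: "k < d \<Longrightarrow> {R k 0, R (Suc k) 0} \<in> skel_E M"
| row: "k \<le> d \<Longrightarrow> p < row_length k \<Longrightarrow> {R k p, R k (Suc p)} \<in> skel_E M"
| port: "k < d \<Longrightarrow> g < M \<Longrightarrow> {R k (row_length k), C g (port k)} \<in> skel_E M"
| copy: "e \<in> F \<Longrightarrow> g < M \<Longrightarrow> C g ` e \<in> skel_E M"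

lemma row_length_mono:
  assumes "k < i" "i \<le> d"
  shows "i + row_length i + b + 1 \<le> k + row_length k"
proof -
  define j where "j = i - Suc k"
  have "d - k = (d - i) + Suc j" and i: "i = k + Suc j" using assms by (simp_all add: j_def)
  then have "row_length k = row_length i + Suc j * (b + 2)"
    by (simp only: row_length_def add_mult_distrib)
  with i show ?thesis by simp
qed

lemma skel_V_intros:
  "k \<le> d \<Longrightarrow> p \<le> row_length k \<Longrightarrow> R k p \<in> skel_V M"
  "g < M \<Longrightarrow> w \<in> W \<Longrightarrow> C g w \<in> skel_V M"
  by (auto simp: skel_V_def)

lemma simple_graph_skel: "simple_graph (skel_V M) (skel_E M)"
  unfolding simple_graph_def
proof (intro conjI ballI)
  have "finite W" using graph by (simp add: simple_graph_def)
  then show "finite (skel_V M)" by (simp add: skel_V_def)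
next
  fix e assume "e \<in> skel_E M"
  then have "e \<subseteq> skel_V M \<and> card e = 2"
  proof cases
    case (main k)
    then have "R k 0 \<in> skel_V M" "R (Suc k) 0 \<in> skel_V M" by (simp_all add: skel_V_intros)
    with main show ?thesis by simp
  next
    case (row k p)
    then have "R k p \<in> skel_V M" "R k (Suc p) \<in> skel_V M" by (simp_all add: skel_V_intros)
    with row show ?thesis by simp
  next
    case (port k g)
    then have "R k (row_length k) \<in> skel_V M" "C g (port k) \<in> skel_V M"
      by (simp_all add: skel_V_intros port_mem)
    with port show ?thesis by simp
  next
    case (copy e0 g)
    then have "e0 \<subseteq> W" "card e0 = 2" using graph by (auto simp: simple_graph_def)
    moreover have "card (C g ` e0) = card e0" by (rule card_image) (simp add: inj_on_def)
    moreover have "C g ` e0 \<subseteq> skel_V M" using \<open>e0 \<subseteq> W\<close> copy(3) skel_V_intros(2) by blast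
    ultimately show ?thesis using copy(1) by simp
  qed
  then show "e \<subseteq> skel_V M" "card e = 2" by auto
qed

lemma card_skel_V: "card (skel_V M) \<le> (d + 1) * (d * (b + 2) + 1) + M * card W"
proof -
  have fin: "finite W" using graph by (simp add: simple_graph_def)
  have "card (R k ` {..row_length k} :: 'w skeleton set) \<le> d * (b + 2) + 1" for k
  proof -
    have "card (R k ` {..row_length k} :: 'w skeleton set) \<le> row_length k + 1"
      using card_image_le[of "{..row_length k}" "R k :: _ \<Rightarrow> 'w skeleton"] by simp
    also have "row_length k \<le> d * (b + 2)" unfolding row_length_def by (rule mult_right_mono) auto
    finally show ?thesis by simp
  qed
  then have "card (\<Union>k\<in>{..d}. R k ` {..row_length k} :: 'w skeleton set) \<le> (\<Sum>k\<in>{..d}. d * (b + 2) + 1)"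
    by (intro order_trans[OF card_UN_le] sum_mono) auto
  moreover have "card (\<Union>g\<in>{..<M}. C g ` W) \<le> (\<Sum>g\<in>{..<M}. card W)"
    by (intro order_trans[OF card_UN_le] sum_mono card_image_le fin) auto
  ultimately show ?thesis
    unfolding skel_V_def using card_Un_le[of "\<Union>k\<in>{..d}. R k ` {..row_length k}" "\<Union>g\<in>{..<M}. C g ` W"]
    by simp
qed

lemma skel_edge_cases:
  assumes "{x, y} \<in> skel_E M"
  obtains (main) k where "k < d" "{x, y} = {R k 0, R (Suc k) 0}"
    | (row) k p where "k \<le> d" "p < row_length k" "{x, y} = {R k p, R k (Suc p)}"
    | (enter) k g where "k < d" "g < M" "x = R k (row_length k)" "y = C g (port k)"
    | (leave) k g where "k < d" "g < M" "x = C g (port k)" "y = R k (row_length k)"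
    | (copy) g u v where "g < M" "{u, v} \<in> F" "x = C g u" "y = C g v"
  using assms
proof (cases rule: skel_E.cases)
  case (port k g)
  with enter[of k g] leave[of k g] show thesis by (auto simp: doubleton_eq_iff)
next
  case (copy e g)
  then have "x \<in> C g ` e" "y \<in> C g ` e" by auto
  then obtain u v where uv: "u \<in> e" "v \<in> e" "x = C g u" "y = C g v" by blast
  then have eq: "C g ` e = C g ` {u, v}" using copy by simp
  have "inj (C g)" by (simp add: inj_on_def)
  from inj_image_eq_iff[OF this, THEN iffD1, OF eq] have "e = {u, v}" .
  with copy uv that(5)[of g u v] show thesis by simp
qed (use main row in blast)+

section \<open>Walks through the skeleton after a failure\<close>

lemma walk_skel_copy:
  assumes "walk F m (port i) w" "i < d" "g < M"
  shows "walk (skel_E M - {{R i 0, R (Suc i) 0}}) (i + row_length i + 1 + m) (R 0 0) (C g w)"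
    (is "walk ?E _ _ _")
proof -
  have main: "walk ?E k (R 0 0) (R k 0)" if "k \<le> i" for k
    using that
  proof (induction k)
    case (Suc k)
    then have "{R k 0, R (Suc k) 0} \<in> ?E" using assms skel_E.main[of k M]
      by (simp add: doubleton_eq_iff)
    from walk.step[OF Suc.IH this] Suc.prems show ?case by simp
  qed simp
  have row: "walk ?E (i + p) (R 0 0) (R i p)" if "p \<le> row_length i" for p
    using that
  proof (induction p)
    case (Suc p)
    then have "{R i p, R i (Suc p)} \<in> ?E" using assms skel_E.row[of i p M]
      by (simp add: doubleton_eq_iff)
    from walk.step[OF Suc.IH this] Suc.prems show ?case by simp
  qed (use main in simp)
  have "{R i (row_length i), C g (port i)} \<in> ?E"
    using assms skel_E.port[of i g M] by (simp add: doubleton_eq_iff)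
  from walk.step[OF row[OF order_refl] this]
  have port: "walk ?E (i + row_length i + 1) (R 0 0) (C g (port i))" by simp
  have "(`) (C g) ` F \<subseteq> ?E"
  proof (rule image_subsetI)
    fix e assume "e \<in> F"
    then have "C g ` e \<in> skel_E M" using assms(3) by (rule skel_E.copy)
    moreover have "R i 0 \<notin> C g ` e" by auto
    then have "C g ` e \<noteq> {R i 0, R (Suc i) 0}" by (metis insertI1)
    ultimately show "C g ` e \<in> ?E" by simp
  qed
  from walk_mono_edges[OF image_walk[OF assms(1)] this]
  have "walk ?E m (C g (port i)) (C g w)" .
  from walk_trans[OF this port] show ?thesis .
qed

text \<open>After the failure of the edge behind \<open>R i 0\<close> every other terminal is reached more than
  \<open>b\<close> too late, so a walk within the stretch enters the copy through port \<open>i\<close> for good.\<close>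

lemma walk_skel_invariant:
  fixes M i :: nat and H :: "'w skeleton set set"
  defines "T \<equiv> i + row_length i"
  defines "E \<equiv> H - {{R i 0, R (Suc i) 0}}"
  assumes "walk E m (R 0 0) x" "H \<subseteq> skel_E M" "i < d"
  shows "case x of R k p \<Rightarrow> (if k \<le> i then min (k + p) (T + b + 1) else T + b + 1) \<le> m
    | C g w \<Rightarrow> min (T + b + 1) (T + 1 + sep i w) \<le> m \<and>
        (T + b + 2 + depth w \<le> m \<or>
         (\<exists>l. l + T + 1 \<le> m \<and> walk {e \<in> F. C g ` e \<in> H} l (port i) w))"
  using assms(3)
proof (induction m "R 0 0 :: 'w skeleton" x rule: walk.induct)
  case (step m x y)
  have xy: "{x, y} \<in> skel_E M" "{x, y} \<in> H" "{x, y} \<noteq> {R i 0, R (Suc i) 0}"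
    using step.hyps(3) assms(4) by (auto simp: E_def)
  note late = row_length_mono[OF _ less_imp_le[OF \<open>i < d\<close>], folded T_def]
  from xy(1) show ?case
  proof (cases rule: skel_edge_cases)
    case (main k)
    with xy(3) have "k \<noteq> i" by auto
    with main step.hyps(2) show ?thesis
      by (auto simp: doubleton_eq_iff split: if_splits)
  next
    case (row k p)
    with step.hyps(2) show ?thesis by (auto simp: doubleton_eq_iff split: if_splits)
  next
    case (enter k g)
    show ?thesis
    proof (cases "k = i")
      case True
      with enter step.hyps(2) have "T \<le> m" by (simp add: T_def)
      with True enter show ?thesis by (auto simp: sep_self intro!: exI[of _ 0])
    next
      case False
      \<comment> \<open>For \<open>k < i\<close> the longer row alone delays the walk by
        \<open>b + 1\<close>; for \<open>k > i\<close> it is late by the induction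
        hypothesis.\<close>
      with enter step.hyps(2) late[of k] have "T + b + 1 \<le> m" by (auto split: if_splits)
      with enter show ?thesis by (simp add: depth_port)
    qed
  next
    case (leave k g)
    show ?thesis
    proof (cases "k = i")
      case True
      with leave step.hyps(2) show ?thesis by (auto simp: T_def)
    next
      case False
      \<comment> \<open>Port \<open>k\<close> has \<open>sep\<close> at least \<open>b\<close>, so a
        walk leaving through it is already too late.\<close>
      with leave step.hyps(2) sep_port[of i k] \<open>i < d\<close> show ?thesis by auto
    qed
  next
    case (copy g u v)
    have "{u, v} \<in> {e \<in> F. C g ` e \<in> H}" using copy xy(2) by simp
    then have ext: "walk {e \<in> F. C g ` e \<in> H} (Suc l) (port i) v"
      if "walk {e \<in> F. C g ` e \<in> H} l (port i) u" for l
      using walk.step[OF that] by blast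
    have "min (T + b + 1) (T + 1 + sep i v) \<le> Suc m"
      using copy step.hyps(2) sep_step[OF \<open>i < d\<close> copy(2)]
      by (auto simp: min_le_iff_disj)
    moreover have "T + b + 2 + depth v \<le> Suc m \<or>
         (\<exists>l. l + T + 1 \<le> Suc m \<and> walk {e \<in> F. C g ` e \<in> H} l (port i) v)"
      using copy step.hyps(2) depth_step[OF copy(2)] ext by fastforce
    ultimately show ?thesis using copy by simp
  qed
qed simp

lemma ft_walk_skel_copy:
  assumes "ft_walk b (skel_V M) (skel_E M) (R 0 0) H" "g < M" "i < d" "w \<in> W"
    and "walk F (depth w) (port i) w"
  shows "walk {e \<in> F. C g ` e \<in> H} (depth w + b) (port i) w"
proof -
  let ?e = "{R i 0, R (Suc i) 0} :: 'w skeleton set"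
  have "C g w \<in> skel_V M" "?e \<in> skel_E M" using assms skel_E.main by (auto simp: skel_V_def)
  with walk_skel_copy[OF assms(5,3,2)] assms(1)
  have w: "walk (H - {?e}) (i + row_length i + 1 + depth w + b) (R 0 0) (C g w)"
    unfolding ft_walk_def by blast
  have "H \<subseteq> skel_E M" using assms(1) by (simp add: ft_walk_def)
  \<comment> \<open>A late entry would need \<open>i + row_length i + b + 2 + depth w\<close> edges,
    one more than allowed; what remains is a walk inside the copy from port
    \<open>i\<close>.\<close>
  from walk_skel_invariant[OF w this assms(3)]
  obtain l where "l \<le> depth w + b" "walk {e \<in> F. C g ` e \<in> H} l (port i) w" by auto
  then show ?thesis by (rule walk_mono_length[rotated])
qed

text \<open>Nonempty edges in different copies are different, so the bounds for the single copies
  add up.\<close>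

lemma ft_walk_skel_card:
  assumes ft: "ft_walk b (skel_V M) (skel_E M) (R 0 0) H"
    and K: "\<And>F'. F' \<subseteq> F \<Longrightarrow>
      (\<And>i w. i < d \<Longrightarrow> w \<in> W \<Longrightarrow> walk F (depth w) (port i) w \<Longrightarrow>
         walk F' (depth w + b) (port i) w) \<Longrightarrow> K \<le> card F'"
  shows "M * K \<le> card H"
proof -
  define Fg where "Fg g = {e \<in> F. C g ` e \<in> H}" for g
  have HE: "H \<subseteq> skel_E M" using ft by (simp add: ft_walk_def)
  have "finite (skel_E M)"
    using simple_graph_skel[of M] unfolding simple_graph_def
    by (auto intro: finite_subset[of _ "Pow (skel_V M)"])
  then have finH: "finite H" using HE finite_subset by blast
  have finF: "finite F" using graph unfolding simple_graph_def
    by (auto intro: finite_subset[of _ "Pow W"])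
  have ne: "e \<noteq> {}" if "e \<in> F" for e using that graph by (auto simp: simple_graph_def)
  have inj: "inj_on ((`) (C g)) (Fg g)" for g
    by (auto simp: inj_on_def)
  have "K \<le> card (Fg g)" if "g < M" for g
    using ft_walk_skel_copy[OF ft that] by (intro K) (auto simp: Fg_def)
  then have "M * K \<le> (\<Sum>g<M. card ((`) (C g) ` Fg g))"
    using sum_mono[of "{..<M}" "\<lambda>_. K"] by (simp add: card_image[OF inj])
  also have "\<dots> = card (\<Union>g\<in>{..<M}. (`) (C g) ` Fg g)"
  proof (rule card_UN_disjoint[symmetric])
    show "\<forall>g\<in>{..<M}. finite ((`) (C g) ` Fg g)" using finF by (auto simp: Fg_def)
    show "\<forall>g\<in>{..<M}. \<forall>g'\<in>{..<M}. g \<noteq> g' \<longrightarrow> (`) (C g) ` Fg g \<inter> (`) (C g') ` Fg g' = {}"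
      using ne by (fastforce simp: Fg_def)
  qed simp
  also have "\<dots> \<le> card H" by (intro card_mono finH) (auto simp: Fg_def)
  finally show ?thesis .
qed

end

subsection \<open>The butterfly gadget\<close>

text \<open>\<open>Row i c\<close> lies on the approach from port \<open>i\<close>, whose length makes leaving a copy through another
  port too expensive; \<open>Pt t v\<close> is the word \<open>v\<close>, read as a number in base \<open>q\<close>, in layer \<open>t\<close>.\<close>

datatype gvert = Row nat nat | Pt nat nat

text \<open>An edge of level \<open>t\<close> may change digit \<open>t\<close> only:
  \<open>mod\<close> fixes the digits below it and \<open>div\<close> those above.\<close>

inductive_set butterfly_E :: "nat \<Rightarrow> nat \<Rightarrow> gvert set set" for q k where
  row: "i < q ^ k \<Longrightarrow> Suc c < k \<Longrightarrow> {Row i c, Row i (Suc c)} \<in> butterfly_E q k"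
| attach: "i < q ^ k \<Longrightarrow> {Row i (k - 1), Pt 0 i} \<in> butterfly_E q k"
| level: "t < k \<Longrightarrow> v < q ^ k \<Longrightarrow> w < q ^ k \<Longrightarrow> v mod q ^ t = w mod q ^ t \<Longrightarrow>
    v div q ^ Suc t = w div q ^ Suc t \<Longrightarrow> {Pt t v, Pt (Suc t) w} \<in> butterfly_E q k"

definition butterfly_V :: "nat \<Rightarrow> nat \<Rightarrow> gvert set" where
  "butterfly_V q k = (\<lambda>(i, c). Row i c) ` ({..<q ^ k} \<times> {..<k}) \<union> (\<lambda>(t, v). Pt t v) ` ({..k} \<times> {..<q ^ k})"

primrec butterfly_depth :: "nat \<Rightarrow> gvert \<Rightarrow> nat" where
  "butterfly_depth k (Row i c) = c"
| "butterfly_depth k (Pt t v) = k + t"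

text \<open>Port \<open>i\<close> is \<open>k\<close> edges away from layer 0, so all points may
  share the value \<open>k\<close>; another \<open>k\<close> edges are spent on the way out along a
  different row.\<close>

primrec butterfly_sep :: "nat \<Rightarrow> nat \<Rightarrow> gvert \<Rightarrow> nat" where
  "butterfly_sep k i (Row j c) = (if j = i then c else 2 * k - c)"
| "butterfly_sep k i (Pt t v) = k"

lemma butterfly_edge_cases:
  assumes "{x, y} \<in> butterfly_E q k"
  obtains (up) i c where "i < q ^ k" "Suc c < k" "x = Row i c" "y = Row i (Suc c)"
  | (down) i c where "i < q ^ k" "Suc c < k" "y = Row i c" "x = Row i (Suc c)"
  | (enter) i where "i < q ^ k" "x = Row i (k - 1)" "y = Pt 0 i"
  | (leave) i where "i < q ^ k" "y = Row i (k - 1)" "x = Pt 0 i"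
  | (forward) t v w where "t < k" "v < q ^ k" "w < q ^ k" "v mod q ^ t = w mod q ^ t"
      "v div q ^ Suc t = w div q ^ Suc t" "x = Pt t v" "y = Pt (Suc t) w"
  | (backward) t v w where "t < k" "v < q ^ k" "w < q ^ k" "v mod q ^ t = w mod q ^ t"
      "v div q ^ Suc t = w div q ^ Suc t" "y = Pt t v" "x = Pt (Suc t) w"
  using assms
proof (cases rule: butterfly_E.cases)
  case (row i c)
  with up[of i c] down[of i c] show thesis by (auto simp: doubleton_eq_iff)
next
  case (attach i)
  with enter[of i] leave[of i] show thesis by (auto simp: doubleton_eq_iff)
next
  case (level t v w)
  with forward[of t v w] backward[of t v w] show thesis
    unfolding doubleton_eq_iff by blast
qed

lemma butterfly_V_simps [simp]:
  "Row i c \<in> butterfly_V q k \<longleftrightarrow> i < q ^ k \<and> c < k"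
  "Pt t v \<in> butterfly_V q k \<longleftrightarrow> t \<le> k \<and> v < q ^ k"
  by (auto simp: butterfly_V_def)

lemma card_butterfly_V: "card (butterfly_V q k) \<le> (2 * k + 1) * q ^ k"
proof -
  have "card (butterfly_V q k) \<le> card ({..<q ^ k} \<times> {..<k}) + card ({..k} \<times> {..<q ^ k})"
    unfolding butterfly_V_def
    by (rule order_trans[OF card_Un_le]) (intro add_mono card_image_le, auto)
  then show ?thesis by (simp add: algebra_simps)
qed

lemma gadget_butterfly:
  assumes "0 < k"
  shows "gadget (butterfly_V q k) (butterfly_E q k) (\<lambda>i. Row i 0) (butterfly_depth k)
    (butterfly_sep k) (q ^ k) (2 * k - 1)"
proof
  have "e \<subseteq> butterfly_V q k \<and> card e = 2" if "e \<in> butterfly_E q k" for e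
    using that assms by cases auto
  then show "simple_graph (butterfly_V q k) (butterfly_E q k)"
    by (simp add: simple_graph_def butterfly_V_def)
  show "butterfly_depth k v \<le> Suc (butterfly_depth k u)" if "{u, v} \<in> butterfly_E q k" for u v
    using that by (cases rule: butterfly_edge_cases) auto
  show "butterfly_sep k i v \<le> Suc (butterfly_sep k i u)" if "{u, v} \<in> butterfly_E q k" for i u v
    using that by (cases rule: butterfly_edge_cases) auto
qed (use assms in auto)

section \<open>Walks through the butterfly\<close>

lemma butterfly_walk:
  assumes "a < q ^ k" "b < q ^ k" "0 < k" "0 < q"
  shows "walk (butterfly_E q k) (k + k) (Row a 0) (Pt k b)"
proof -
  \<comment> \<open>The word reached in layer \<open>t\<close>: its lowest \<open>t\<close> digits
    are already those of \<open>b\<close>, the others still those of \<open>a\<close>.\<close>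
  define mix where "mix t = b mod q ^ t + a div q ^ t * q ^ t" for t
  have less: "mix t < q ^ k" if "t \<le> k" for t
  proof -
    have split: "q ^ k = q ^ (k - t) * q ^ t" using that by (simp flip: power_add)
    have "a div q ^ t < q ^ (k - t)"
      using assms split by (simp add: less_mult_imp_div_less)
    then have "Suc (a div q ^ t) * q ^ t \<le> q ^ k" unfolding split by (intro mult_right_mono) auto
    moreover have "b mod q ^ t < q ^ t" using assms by simp
    ultimately show ?thesis by (simp add: mix_def)
  qed
  have mod: "mix t mod q ^ t = b mod q ^ t" "mix t div q ^ t = a div q ^ t" for t
    using assms by (simp_all add: mix_def)
  have mod': "mix (Suc t) mod q ^ t = b mod q ^ t" for t
    using mod(1)[of "Suc t"] mod_mod_cancel[of "q ^ t" "q ^ Suc t"] by (metis dvd_triv_right power_Suc)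
  have div': "mix t div q ^ Suc t = a div q ^ Suc t" for t
    using mod(2)[of t] by (metis div_mult2_eq power_Suc2)
  have row: "walk (butterfly_E q k) c (Row a 0) (Row a c)" if "c < k" for c
    using that
  proof (induction c)
    case (Suc c)
    from walk.step[OF Suc.IH butterfly_E.row[of a q k c]] Suc.prems assms show ?case by simp
  qed simp
  have "walk (butterfly_E q k) (k + t) (Row a 0) (Pt t (mix t))" if "t \<le> k" for t
    using that
  proof (induction t)
    case 0
    have "mix 0 = a" by (simp add: mix_def)
    with walk.step[OF row butterfly_E.attach[of a q k]] assms show ?case by simp
  next
    case (Suc t)
    have "{Pt t (mix t), Pt (Suc t) (mix (Suc t))} \<in> butterfly_E q k"
      using Suc.prems less[of t] less[of "Suc t"] mod[of t] mod' mod[of "Suc t"] div'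
      by (intro butterfly_E.level) auto
    from walk.step[OF Suc.IH this] Suc.prems show ?case by simp
  qed
  from this[of k] show ?thesis using assms by (simp add: mix_def)
qed

text \<open>A walk crossing a level for the only time leaves the digits below it untouched afterwards
  and has left the digits above it untouched before.  So a walk without an edge that fits the
  prefix of \<open>b\<close> and the suffix of \<open>a\<close> crosses every level at least three times.  In the potential,
  the first sum counts the levels below that need two extra crossings because the prefix already
  agrees with \<open>b\<close>, the second sum those above that were crossed back and forth since the suffix
  differs from \<open>a\<close>.\<close>

definition crossings :: "nat \<Rightarrow> nat \<Rightarrow> nat \<Rightarrow> nat \<Rightarrow> nat \<Rightarrow> nat \<Rightarrow> nat" where
  "crossings q k a b t w = t
     + (\<Sum>j<t. if w mod q ^ Suc j = b mod q ^ Suc j then 2 else 0)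
     + (\<Sum>j=t..<k. if w div q ^ j \<noteq> a div q ^ j then 2 else 0)"

text \<open>Shorter prefixes and longer suffixes survive the edge, so only the summand for
  \<open>j = t\<close> moves from the second sum to the first. A forward crossing thus raises the
  potential by more than one only if the suffix fits \<open>a\<close> and the prefix fits
  \<open>b\<close>.\<close>

lemma crossings_Suc:
  assumes "t < k" and mod: "v mod q ^ t = w mod q ^ t"
    and div: "v div q ^ Suc t = w div q ^ Suc t"
  shows "crossings q k a b (Suc t) w + (if v div q ^ t \<noteq> a div q ^ t then 2 else 0)
    = crossings q k a b t v + 1 + (if w mod q ^ Suc t = b mod q ^ Suc t then 2 else 0)"
proof -
  have "(v mod q ^ Suc j = b mod q ^ Suc j) = (w mod q ^ Suc j = b mod q ^ Suc j)" if "j < t" for j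
  proof -
    have "q ^ Suc j dvd q ^ t" using that by (intro le_imp_power_dvd) simp
    with mod show ?thesis by (metis mod_mod_cancel)
  qed
  then have 1: "(\<Sum>j<t. if v mod q ^ Suc j = b mod q ^ Suc j then 2 else 0 :: nat)
      = (\<Sum>j<t. if w mod q ^ Suc j = b mod q ^ Suc j then 2 else 0)"
    by (intro sum.cong) auto
  have "v div q ^ j = w div q ^ j" if "Suc t \<le> j" for j
  proof -
    have "q ^ j = q ^ Suc t * q ^ (j - Suc t)" using that by (metis le_add_diff_inverse power_add)
    with div show ?thesis by (metis div_mult2_eq)
  qed
  then have 2: "(\<Sum>j=Suc t..<k. if v div q ^ j \<noteq> a div q ^ j then 2 else 0 :: nat)
      = (\<Sum>j=Suc t..<k. if w div q ^ j \<noteq> a div q ^ j then 2 else 0)"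
    by (intro sum.cong) auto
  have "(\<Sum>j=t..<k. if v div q ^ j \<noteq> a div q ^ j then 2 else 0 :: nat)
    = (if v div q ^ t \<noteq> a div q ^ t then 2 else 0)
      + (\<Sum>j=Suc t..<k. if v div q ^ j \<noteq> a div q ^ j then 2 else 0)"
    using assms(1) by (simp add: sum.atLeast_Suc_lessThan)
  then show ?thesis unfolding crossings_def 1 2 by simp
qed

lemma butterfly_long_walk:
  assumes walk: "walk E m (Row a 0) (Pt k b)" and sub: "E \<subseteq> butterfly_E q k"
    and none: "\<And>t v w. {Pt t v, Pt (Suc t) w} \<in> E \<Longrightarrow>
      \<not> (v div q ^ t = a div q ^ t \<and> w mod q ^ Suc t = b mod q ^ Suc t)"
    and "0 < k"
  shows "4 * k \<le> m"
proof -
  \<comment> \<open>Along the row of \<open>a\<close> edges are counted; every other row is a dead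
    end and takes the constant value of the point where it is attached.\<close>
  define pot where "pot x = (case x of
      Row i c \<Rightarrow> if i = a then c else k + crossings q k a b 0 i
    | Pt t v \<Rightarrow> k + crossings q k a b t v)" for x
  have a: "crossings q k a b 0 a = 0" by (simp add: crossings_def)
  have "pot y \<le> Suc (pot x)" if xy: "{x, y} \<in> E" for x y
  proof -
    from xy sub have "{x, y} \<in> butterfly_E q k" by blast
    then show ?thesis
    proof (cases rule: butterfly_edge_cases)
      case (forward t v w)
      with none[of t v w] xy crossings_Suc[of t k v q w a b] show ?thesis
        by (auto simp: pot_def split: if_splits)
    next
      case (backward t v w)
      with crossings_Suc[of t k v q w a b] show ?thesis
        by (auto simp: pot_def split: if_splits)
    qed (use a \<open>0 < k\<close> in \<open>auto simp: pot_def\<close>)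
  qed
  from walk_potential[where pot = pot, OF walk this] have "pot (Pt k b) \<le> m" by (simp add: pot_def)
  \<comment> \<open>At \<open>Pt k b\<close> every prefix agrees, so the potential is
    \<open>k + k + 2 * k\<close>.\<close>
  then show ?thesis by (simp add: pot_def crossings_def)
qed

lemma eq_of_div_mod: "x div m = y div m \<Longrightarrow> x mod m = y mod m \<Longrightarrow> x = y" for x y m :: nat
  by (metis div_mult_mod_eq)

section \<open>Counting the butterfly edges that are needed\<close>

lemma card_same_div:
  fixes q :: nat
  assumes "0 < q"
  shows "card {a. a < q ^ k \<and> a div q ^ t = v} \<le> q ^ t"
proof -
  have "inj_on (\<lambda>a. a mod q ^ t) {a. a < q ^ k \<and> a div q ^ t = v}"
    by (rule inj_onI) (metis (mono_tags, lifting) eq_of_div_mod mem_Collect_eq)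
  moreover have "(\<lambda>a. a mod q ^ t) ` {a. a < q ^ k \<and> a div q ^ t = v} \<subseteq> {..<q ^ t}"
    using assms by auto
  ultimately have "card {a. a < q ^ k \<and> a div q ^ t = v} \<le> card {..<q ^ t}"
    by (rule card_inj_on_le) simp
  then show ?thesis by simp
qed

lemma card_same_mod:
  "card {b. b < q ^ k \<and> b mod q ^ t = w} \<le> q ^ (k - t)" if "0 < q" "t \<le> k" for q :: nat
proof (rule order_trans)
  have "q ^ k = q ^ (k - t) * q ^ t" using that by (simp flip: power_add)
  then show "card {b. b < q ^ k \<and> b mod q ^ t = w} \<le> card {..<q ^ (k - t)}"
    using that by (intro card_inj_on_le[of "\<lambda>b. b div q ^ t"] inj_onI)
      (auto intro: eq_of_div_mod simp: less_mult_imp_div_less)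
qed simp

text \<open>Double counting: each of the \<open>q ^ k * q ^ k\<close> pairs \<open>(a, b)\<close>
  needs an edge of \<open>F\<close> that fits it, while an edge of level \<open>t\<close> fits at
  most \<open>q ^ t\<close> words \<open>a\<close> and \<open>q ^ (k - Suc t)\<close> words
  \<open>b\<close>.\<close>

lemma butterfly_card:
  assumes "0 < k" "0 < q" and sub: "F \<subseteq> butterfly_E q k"
    and short: "\<And>i w. i < q ^ k \<Longrightarrow> w \<in> butterfly_V q k \<Longrightarrow>
      walk (butterfly_E q k) (butterfly_depth k w) (Row i 0) w \<Longrightarrow>
      walk F (butterfly_depth k w + (2 * k - 1)) (Row i 0) w"
  shows "q ^ (k + 1) \<le> card F"
proof -
  define P where "P e = {(a, b). a < q ^ k \<and> b < q ^ k \<and> (\<exists>t v w. e = {Pt t v, Pt (Suc t) w} \<and>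
      v div q ^ t = a div q ^ t \<and> w mod q ^ Suc t = b mod q ^ Suc t)}" for e
  have finF: "finite F"
  proof (rule finite_subset)
    have "butterfly_E q k \<subseteq> Pow (butterfly_V q k)"
      using gadget.graph[OF gadget_butterfly[OF assms(1)], of q] by (auto simp: simple_graph_def)
    with sub show "F \<subseteq> Pow (butterfly_V q k)" by (rule order_trans)
  qed (simp add: butterfly_V_def)
  have hit: "\<exists>e\<in>F. (a, b) \<in> P e" if "a < q ^ k" "b < q ^ k" for a b
  proof (rule ccontr)
    assume none: "\<not> (\<exists>e\<in>F. (a, b) \<in> P e)"
    have "walk F (k + k + (2 * k - 1)) (Row a 0) (Pt k b)"
      using short[of a "Pt k b"] butterfly_walk[OF that assms(1,2)] that
      by (simp only: butterfly_depth.simps butterfly_V_simps order_refl simp_thms)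
    moreover have "\<not> (v div q ^ t = a div q ^ t \<and> w mod q ^ Suc t = b mod q ^ Suc t)"
      if "{Pt t v, Pt (Suc t) w} \<in> F" for t v w
    proof
      assume "v div q ^ t = a div q ^ t \<and> w mod q ^ Suc t = b mod q ^ Suc t"
      then have "(a, b) \<in> P {Pt t v, Pt (Suc t) w}"
        using \<open>a < q ^ k\<close> \<open>b < q ^ k\<close> unfolding P_def by blast
      from bexI[of "\<lambda>e. (a, b) \<in> P e", OF this that] none show False by (rule notE[rotated])
    qed
    \<comment> \<open>The slack \<open>2 * k - 1\<close> on top of the length \<open>k + k\<close>
      stays one below the bound.\<close>
    ultimately have "4 * k \<le> k + k + (2 * k - 1)"
      by (intro butterfly_long_walk[where a = a and b = b, OF _ sub _ assms(1)])
    with assms(1) show False by linarith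
  qed
  have cover: "{..<q ^ k} \<times> {..<q ^ k} \<subseteq> (\<Union>e\<in>F. P e)"
  proof
    fix x assume "x \<in> {..<q ^ k} \<times> {..<q ^ k}"
    then have "fst x < q ^ k" "snd x < q ^ k" by auto
    from hit[OF this] show "x \<in> (\<Union>e\<in>F. P e)" by simp
  qed
  have finP: "finite (P e)" for e
  proof (rule finite_subset)
    show "P e \<subseteq> {..<q ^ k} \<times> {..<q ^ k}" unfolding P_def by blast
  qed simp
  have "card (P e) \<le> q ^ (k - 1)" if "e \<in> F" for e
  proof (cases "P e = {}")
    case False
    then obtain x where "x \<in> P e" by blast
    then obtain t v w where e: "e = {Pt t v, Pt (Suc t) w}" unfolding P_def by blast
    with that sub have "{Pt t v, Pt (Suc t) w} \<in> butterfly_E q k" by blast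
    then have t: "t < k" by (cases rule: butterfly_edge_cases) auto
    have "P e \<subseteq> {a. a < q ^ k \<and> a div q ^ t = v div q ^ t} \<times>
        {b. b < q ^ k \<and> b mod q ^ Suc t = w mod q ^ Suc t}" (is "_ \<subseteq> ?A \<times> ?B")
    proof
      fix x assume "x \<in> P e"
      then obtain a b t' v' w' where x: "x = (a, b)" "a < q ^ k" "b < q ^ k" "e = {Pt t' v', Pt (Suc t') w'}"
        "v' div q ^ t' = a div q ^ t'" "w' mod q ^ Suc t' = b mod q ^ Suc t'"
        unfolding P_def by blast
      then have "t' = t" "v' = v" "w' = w" using e by (auto simp: doubleton_eq_iff)
      with x show "x \<in> ?A \<times> ?B" by simp
    qed
    moreover have "finite (?A \<times> ?B)" by simp
    ultimately have "card (P e) \<le> card (?A \<times> ?B)" by (rule card_mono[rotated])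
    also have "\<dots> \<le> q ^ t * q ^ (k - Suc t)"
      unfolding card_cartesian_product using t assms
      by (intro mult_mono card_same_div card_same_mod) auto
    also have "\<dots> = q ^ (k - 1)" using t by (simp flip: power_add)
    finally show ?thesis .
  qed simp
  then have "(\<Sum>e\<in>F. card (P e)) \<le> card F * q ^ (k - 1)"
    using sum_bounded_above[of F "\<lambda>e. card (P e)" "q ^ (k - 1)"] by simp
  moreover have "card ({..<q ^ k} \<times> {..<q ^ k}) \<le> (\<Sum>e\<in>F. card (P e))"
    using order_trans[OF card_mono[OF _ cover] card_UN_le[OF finF]] finF finP by simp
  ultimately have "q ^ k * q ^ k \<le> card F * q ^ (k - 1)" by simp
  moreover have "k + k = (k + 1) + (k - 1)" using assms(1) by simp
  then have "q ^ k * q ^ k = q ^ (k + 1) * q ^ (k - 1)" by (simp only: power_add[symmetric])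
  ultimately have "q ^ (k + 1) * q ^ (k - 1) \<le> card F * q ^ (k - 1)" by simp
  then show ?thesis using assms(2) by (simp only: mult_le_cancel2) simp
qed

subsection \<open>The greedy gadget\<close>

text \<open>Walks with at most \<open>p\<close> edges in \<open>A\<close> and at most \<open>l\<close> edges altogether.  Only the former branch a
  lot, so counting them separately keeps the base of the exponent \<open>l\<close> constant.\<close>

inductive mixed_walk :: "'a set set \<Rightarrow> 'a set set \<Rightarrow> nat \<Rightarrow> nat \<Rightarrow> 'a \<Rightarrow> 'a \<Rightarrow> bool"
  for D A where
  refl [simp]: "mixed_walk D A p l u u"
| plain: "mixed_walk D A p l u v \<Longrightarrow> {v, w} \<in> D \<Longrightarrow> mixed_walk D A p (Suc l) u w"
| marked: "mixed_walk D A p l u v \<Longrightarrow> {v, w} \<in> A \<Longrightarrow> mixed_walk D A (Suc p) (Suc l) u w"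

lemma mixed_walk_mono_length:
  "mixed_walk D A p l u v \<Longrightarrow> p \<le> p' \<Longrightarrow> l \<le> l' \<Longrightarrow> mixed_walk D A p' l' u v"
proof (induction arbitrary: p' l' rule: mixed_walk.induct)
  case (plain p l u v w)
  then obtain l'' where l'': "l' = Suc l''" "l \<le> l''" by (cases l') auto
  from mixed_walk.plain[OF plain.IH[OF plain.prems(1) l''(2)] plain.hyps(2)] l''(1)
  show ?case by simp
next
  case (marked p l u v w)
  then obtain p'' where p'': "p' = Suc p''" "p \<le> p''" by (cases p') auto
  from marked obtain l'' where l'': "l' = Suc l''" "l \<le> l''" by (cases l') auto
  from mixed_walk.marked[OF marked.IH[OF p''(2) l''(2)] marked.hyps(2)] l''(1) p''(1)
  show ?case by simp
qed simp

lemma mixed_walk_mono_edges: "mixed_walk D A p l u v \<Longrightarrow> A \<subseteq> A' \<Longrightarrow> mixed_walk D A' p l u v"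
proof (induction rule: mixed_walk.induct)
  case (marked p l u v w)
  then show ?case by (intro mixed_walk.marked[of D A' p l u v w]) auto
qed (auto intro: mixed_walk.plain)

lemma mixed_walk_trans:
  "mixed_walk D A p' l' v w \<Longrightarrow> mixed_walk D A p l u v \<Longrightarrow> mixed_walk D A (p + p') (l + l') u w"
proof (induction rule: mixed_walk.induct)
  case (refl p' l' v)
  then show ?case by (rule mixed_walk_mono_length) auto
next
  case (plain p' l' v w x)
  from mixed_walk.plain[OF plain.IH[OF plain.prems] plain.hyps(2)] show ?case by simp
next
  case (marked p' l' v w x)
  from mixed_walk.marked[OF marked.IH[OF marked.prems] marked.hyps(2)] show ?case by simp
qed

lemma mixed_walk_plain_edge: "{u, v} \<in> D \<Longrightarrow> mixed_walk D A 0 1 u v"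
  using mixed_walk.plain[OF mixed_walk.refl[of D A 0 0 u]] by simp

lemma mixed_walk_marked_edge: "{u, v} \<in> A \<Longrightarrow> mixed_walk D A 1 1 u v"
  using mixed_walk.marked[OF mixed_walk.refl[of D A 0 0 u]] by simp

lemma mixed_walk_sym: "mixed_walk D A p l u v \<Longrightarrow> mixed_walk D A p l v u"
proof (induction rule: mixed_walk.induct)
  case (plain p l u v w)
  then have "mixed_walk D A 0 1 w v" by (intro mixed_walk_plain_edge) (simp add: insert_commute)
  from mixed_walk_trans[OF plain.IH this] show ?case by simp
next
  case (marked p l u v w)
  then have "mixed_walk D A 1 1 w v" by (intro mixed_walk_marked_edge) (simp add: insert_commute)
  from mixed_walk_trans[OF marked.IH this] show ?case by simp
qed simp

text \<open>The last edge is absent, plain with at most two choices, or marked with at most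
  \<open>r\<close> choices while \<open>p\<close> drops by one; hence the factor
  \<open>1 + 2 + 1\<close> per unit of length.\<close>

lemma card_mixed_walk:
  assumes D: "\<And>v. finite {w. {v, w} \<in> D} \<and> card {w. {v, w} \<in> D} \<le> 2"
    and A: "\<And>v. finite {w. {v, w} \<in> A} \<and> card {w. {v, w} \<in> A} \<le> r"
    and "1 \<le> r"
  shows "finite {v. mixed_walk D A p l u v} \<and> card {v. mixed_walk D A p l u v} \<le> 4 ^ l * r ^ p"
proof (induction l arbitrary: p)
  case 0
  have "{v. mixed_walk D A p 0 u v} = {u}" by (auto elim: mixed_walk.cases)
  with assms(3) show ?case by simp
next
  case (Suc l)
  define N where "N p = {v. mixed_walk D A p l u v}" for p
  have N: "finite (N p)" "card (N p) \<le> 4 ^ l * r ^ p" for p using Suc.IH by (auto simp: N_def)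
  have nbrs: "finite (\<Union>v\<in>N p. {w. {v, w} \<in> B}) \<and>
      card (\<Union>v\<in>N p. {w. {v, w} \<in> B}) \<le> 4 ^ l * r ^ p * k"
    if B: "\<And>v. finite {w. {v, w} \<in> B} \<and> card {w. {v, w} \<in> B} \<le> k" for B p k
  proof
    show "finite (\<Union>v\<in>N p. {w. {v, w} \<in> B})" using N B by blast
    have "card (\<Union>v\<in>N p. {w. {v, w} \<in> B}) \<le> (\<Sum>v\<in>N p. card {w. {v, w} \<in> B})"
      by (rule card_UN_le[OF N(1)])
    also have "\<dots> \<le> card (N p) * k" using sum_bounded_above[of "N p" _ k] B by simp
    also have "\<dots> \<le> 4 ^ l * r ^ p * k" using N by (intro mult_right_mono) auto
    finally show "card (\<Union>v\<in>N p. {w. {v, w} \<in> B}) \<le> 4 ^ l * r ^ p * k" .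
  qed
  define X where "X = (\<Union>v\<in>N p. {w. {v, w} \<in> D})"
  define Y where "Y = (if p = 0 then {} else \<Union>v\<in>N (p - 1). {w. {v, w} \<in> A})"
  have X: "finite X" "card X \<le> 4 ^ l * r ^ p * 2" unfolding X_def using nbrs D by blast+
  have Y: "finite Y \<and> card Y \<le> 4 ^ l * r ^ p"
  proof (cases p)
    case (Suc p')
    then have "finite Y \<and> card Y \<le> 4 ^ l * r ^ p' * r" unfolding Y_def using nbrs[OF A] by simp
    then show ?thesis using Suc by (simp add: algebra_simps)
  qed (simp add: Y_def)
  have sub: "{v. mixed_walk D A p (Suc l) u v} \<subseteq> N p \<union> X \<union> Y"
  proof
    fix w assume "w \<in> {v. mixed_walk D A p (Suc l) u v}"
    then have "mixed_walk D A p (Suc l) u w" by simp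
    then show "w \<in> N p \<union> X \<union> Y"
      by cases (auto simp: N_def X_def Y_def)
  qed
  have fin: "finite (N p \<union> X \<union> Y)" using N X Y by simp
  have "card {v. mixed_walk D A p (Suc l) u v} \<le> card (N p \<union> X \<union> Y)"
    by (rule card_mono[OF fin sub])
  also have "\<dots> \<le> card (N p) + card X + card Y"
    using card_Un_le[of "N p \<union> X" Y] card_Un_le[of "N p" X] by linarith
  also have "\<dots> \<le> 4 ^ l * r ^ p + 4 ^ l * r ^ p * 2 + 4 ^ l * r ^ p"
    using N X Y by (intro add_mono) auto
  also have "\<dots> = 4 ^ Suc l * r ^ p" by simp
  finally show ?case using finite_subset[OF sub fin] by simp
qed

section \<open>Edge sets without short bypasses\<close>

definition walk_via :: "'a set \<Rightarrow> 'a set set \<Rightarrow> 'a set set \<Rightarrow> nat \<Rightarrow> nat \<Rightarrow> 'a \<Rightarrow> 'a \<Rightarrow> bool" where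
  "walk_via e D A p l u v \<longleftrightarrow> (\<exists>s t p1 l1 p2 l2. s \<in> e \<and> t \<in> e \<and> mixed_walk D A p1 l1 u s \<and>
     mixed_walk D A p2 l2 t v \<and> p1 + p2 + 1 \<le> p \<and> l1 + l2 + 1 \<le> l)"

lemma walk_viaI:
  assumes "s \<in> e" "t \<in> e" "mixed_walk D A p1 l1 u s" "mixed_walk D A p2 l2 t v"
    "p1 + p2 + 1 \<le> p" "l1 + l2 + 1 \<le> l"
  shows "walk_via e D A p l u v"
  using assms unfolding walk_via_def by blast

lemma walk_viaE:
  assumes "walk_via e D A p l u v"
  obtains s t p1 l1 p2 l2 where "s \<in> e" "t \<in> e" "mixed_walk D A p1 l1 u s"
    "mixed_walk D A p2 l2 t v" "p1 + p2 + 1 \<le> p" "l1 + l2 + 1 \<le> l"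
  using assms unfolding walk_via_def by blast

text \<open>Only the first entry into \<open>e\<close> and the last exit are recorded: both outer
  pieces run in \<open>D\<close> and \<open>A\<close>, and whatever lies between them contains at
  least one marked edge.\<close>

lemma mixed_walk_insert:
  "mixed_walk D (insert e A) p l u v \<Longrightarrow> mixed_walk D A p l u v \<or> walk_via e D A p l u v"
proof (induction rule: mixed_walk.induct)
  case (plain p l u v w)
  from plain.IH show ?case
  proof
    assume "mixed_walk D A p l u v"
    then have "mixed_walk D A p (Suc l) u w" using plain.hyps(2) by (rule mixed_walk.plain)
    then show ?thesis ..
  next
    assume "walk_via e D A p l u v"
    then show ?thesis
    proof (cases rule: walk_viaE)
      case (1 s t p1 l1 p2 l2)
      have "mixed_walk D A p2 (Suc l2) t w" using 1(4) plain.hyps(2) by (rule mixed_walk.plain)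
      from walk_viaI[OF 1(1-3) this] 1(5,6) show ?thesis by simp
    qed
  qed
next
  case (marked p l u v w)
  show ?case
  proof (cases "{v, w} = e")
    case True
    then have vw: "v \<in> e" "w \<in> e" by blast+
    from marked.IH show ?thesis
    proof
      assume "mixed_walk D A p l u v"
      from walk_viaI[OF vw this, of 0 0 w] show ?thesis by simp
    next
      assume "walk_via e D A p l u v"
      then show ?thesis
      proof (cases rule: walk_viaE)
        case (1 s t p1 l1 p2 l2)
        from walk_viaI[OF 1(1) vw(2) 1(3), of 0 0 w] 1(5,6) show ?thesis by simp
      qed
    qed
  next
    case False
    with marked.hyps(2) have vw: "{v, w} \<in> A" by simp
    from marked.IH show ?thesis
    proof
      assume "mixed_walk D A p l u v"
      then have "mixed_walk D A (Suc p) (Suc l) u w" using vw by (rule mixed_walk.marked)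
      then show ?thesis ..
    next
      assume "walk_via e D A p l u v"
      then show ?thesis
      proof (cases rule: walk_viaE)
        case (1 s t p1 l1 p2 l2)
        have "mixed_walk D A (Suc p2) (Suc l2) t w" using 1(4) vw by (rule mixed_walk.marked)
        from walk_viaI[OF 1(1-3) this] 1(5,6) show ?thesis by simp
      qed
    qed
  qed
qed simp

text \<open>A girth condition with two budgets, \<open>p\<close> for marked edges and
  \<open>l\<close> for all edges.\<close>

definition no_bypass :: "'a set set \<Rightarrow> nat \<Rightarrow> nat \<Rightarrow> 'a set set \<Rightarrow> bool" where
  "no_bypass D p l A \<longleftrightarrow> (\<forall>u v. {u, v} \<in> A \<longrightarrow> \<not> mixed_walk D (A - {{u, v}}) p l u v)"

text \<open>A bypass of an old edge \<open>{u, v}\<close> through the new one can be turned round: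
  from one end of the new edge back to \<open>u\<close>, across \<open>{u, v}\<close>, and from
  \<open>v\<close> back to the other end. The two edges swap places, so the same budgets suffice to
  join \<open>x\<close> and \<open>y\<close>.\<close>

lemma no_bypass_insert:
  assumes A: "no_bypass D p l A" and xy: "\<not> mixed_walk D A p l x y"
  shows "no_bypass D p l (insert {x, y} A)"
  unfolding no_bypass_def
proof (intro allI impI notI)
  have yx: "\<not> mixed_walk D A p l s t" if "s \<in> {x, y}" "t \<in> {x, y}" "s \<noteq> t" for s t
    using that xy mixed_walk_sym[of D A p l] by auto
  fix u v
  assume uv: "{u, v} \<in> insert {x, y} A"
    and walk: "mixed_walk D (insert {x, y} A - {{u, v}}) p l u v"
  show False
  proof (cases "{u, v} = {x, y}")
    case True
    then have "insert {x, y} A - {{u, v}} \<subseteq> A" by auto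
    from mixed_walk_mono_edges[OF walk this] True xy mixed_walk_sym[of D A p l]
    show False by (auto simp: doubleton_eq_iff)
  next
    case False
    with uv have uvA: "{u, v} \<in> A" by simp
    from False have "insert {x, y} A - {{u, v}} = insert {x, y} (A - {{u, v}})" by auto
    with walk have "mixed_walk D (insert {x, y} (A - {{u, v}})) p l u v" by simp
    from mixed_walk_insert[OF this] show False
    proof (elim disjE walk_viaE)
      assume "mixed_walk D (A - {{u, v}}) p l u v"
      with A uvA show False by (simp add: no_bypass_def)
    next
      fix s t p1 l1 p2 l2
      assume st: "s \<in> {x, y}" "t \<in> {x, y}"
        and us: "mixed_walk D (A - {{u, v}}) p1 l1 u s"
        and tv: "mixed_walk D (A - {{u, v}}) p2 l2 t v"
        and len: "p1 + p2 + 1 \<le> p" "l1 + l2 + 1 \<le> l"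
      show False
      proof (cases "s = t")
        case True
        from mixed_walk_trans[OF tv[folded True] us]
        have "mixed_walk D (A - {{u, v}}) p l u v"
          by (rule mixed_walk_mono_length) (use len in auto)
        with A uvA show False by (simp add: no_bypass_def)
      next
        case False
        note mono = mixed_walk_mono_edges[where A = "A - {{u, v}}" and A' = A, OF _ Diff_subset]
        from mixed_walk_trans[OF mixed_walk_trans[OF mixed_walk_sym[OF mono[OF tv]]
              mixed_walk_marked_edge[OF uvA]] mixed_walk_sym[OF mono[OF us]]]
        have "mixed_walk D A p l s t"
          by (rule mixed_walk_mono_length) (use len in auto)
        with yx[OF st False] show False by simp
      qed
    qed
  qed
qed

section \<open>The comb and its maximal sets of teeth\<close>

definition comb_rows :: "nat \<Rightarrow> nat \<Rightarrow> gvert set set" where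
  "comb_rows d L = {{Row i c, Row i (Suc c)} |i c. i < d \<and> Suc c < 2 * L}"

text \<open>The candidates for the greedy choice: a complete bipartite graph in each column from
  \<open>L\<close> on. The first \<open>L\<close> columns stay free, which keeps the ports
  apart.\<close>

definition comb_teeth :: "nat \<Rightarrow> nat \<Rightarrow> gvert set set" where
  "comb_teeth d L = {{Row i c, Pt c x} |i c x. i < d \<and> L \<le> c \<and> c < 2 * L \<and> x < d}"

definition comb_V :: "nat \<Rightarrow> nat \<Rightarrow> gvert set" where
  "comb_V d L = (\<lambda>(i, c). Row i c) ` ({..<d} \<times> {..<2 * L}) \<union> (\<lambda>(c, x). Pt c x) ` ({L..<2 * L} \<times> {..<d})"

lemma comb_V_simps [simp]:
  "Row i c \<in> comb_V d L \<longleftrightarrow> i < d \<and> c < 2 * L"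
  "Pt c x \<in> comb_V d L \<longleftrightarrow> L \<le> c \<and> c < 2 * L \<and> x < d"
  by (auto simp: comb_V_def)

lemma card_comb_V: "card (comb_V d L) \<le> 3 * L * d"
proof -
  have "card (comb_V d L) \<le> card ({..<d} \<times> {..<2 * L}) + card ({L..<2 * L} \<times> {..<d})"
    unfolding comb_V_def
    by (rule order_trans[OF card_Un_le]) (intro add_mono card_image_le, auto)
  then show ?thesis by (simp add: algebra_simps)
qed

lemma comb_rows_cases:
  assumes "{x, y} \<in> comb_rows d L"
  obtains (up) i c where "i < d" "Suc c < 2 * L" "x = Row i c" "y = Row i (Suc c)"
  | (down) i c where "i < d" "Suc c < 2 * L" "y = Row i c" "x = Row i (Suc c)"
proof -
  from assms obtain i c where "i < d" "Suc c < 2 * L" "{x, y} = {Row i c, Row i (Suc c)}"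
    unfolding comb_rows_def by blast
  with up[of i c] down[of i c] show thesis by (auto simp: doubleton_eq_iff)
qed

lemma comb_teeth_cases:
  assumes "{x, y} \<in> comb_teeth d L"
  obtains (enter) i c z where "i < d" "L \<le> c" "c < 2 * L" "z < d" "x = Row i c" "y = Pt c z"
  | (leave) i c z where "i < d" "L \<le> c" "c < 2 * L" "z < d" "y = Row i c" "x = Pt c z"
proof -
  from assms obtain i c z where "i < d" "L \<le> c" "c < 2 * L" "z < d" "{x, y} = {Row i c, Pt c z}"
    unfolding comb_teeth_def by blast
  with enter[of i c z] leave[of i c z] show thesis by (auto simp: doubleton_eq_iff)
qed

primrec comb_depth :: "gvert \<Rightarrow> nat" where
  "comb_depth (Row i c) = c"
| "comb_depth (Pt c x) = c + 1"

text \<open>Capping at column \<open>L\<close> gives every vertex incident with a tooth the value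
  \<open>L\<close>, so no choice of teeth affects it.\<close>

primrec comb_sep :: "nat \<Rightarrow> nat \<Rightarrow> gvert \<Rightarrow> nat" where
  "comb_sep L i (Row j c) = (if j = i then min c L else 2 * L - min c L)"
| "comb_sep L i (Pt c x) = L"

lemma gadget_comb:
  assumes A: "A \<subseteq> comb_teeth d L" and "0 < L"
  shows "gadget (comb_V d L) (comb_rows d L \<union> A) (\<lambda>i. Row i 0) comb_depth (comb_sep L) d L"
proof
  have "e \<subseteq> comb_V d L \<and> card e = 2" if "e \<in> comb_rows d L \<union> comb_teeth d L" for e
    using that by (auto simp: comb_rows_def comb_teeth_def)
  then show "simple_graph (comb_V d L) (comb_rows d L \<union> A)"
    using A by (auto simp: simple_graph_def comb_V_def)
  fix u v assume "{u, v} \<in> comb_rows d L \<union> A"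
  with A have uv: "{u, v} \<in> comb_rows d L \<or> {u, v} \<in> comb_teeth d L" by blast
  then show "comb_depth v \<le> Suc (comb_depth u)"
    by (auto elim: comb_rows_cases comb_teeth_cases)
  show "comb_sep L i v \<le> Suc (comb_sep L i u)" for i
    using uv
  proof
    assume "{u, v} \<in> comb_rows d L"
    then show ?thesis by (cases rule: comb_rows_cases) auto
  next
    assume "{u, v} \<in> comb_teeth d L"
    then show ?thesis by (cases rule: comb_teeth_cases) auto
  qed
qed (use \<open>0 < L\<close> in auto)

lemma card_nbrs_insert:
  "card {w. {v, w} \<in> insert {a, b} A} \<le> card {w. {v, w} \<in> A} + (if v \<in> {a, b} then 1 else 0)"
proof (cases "v \<in> {a, b}")
  case True
  then have "{w. {v, w} \<in> insert {a, b} A} \<subseteq> insert (if v = a then b else a) {w. {v, w} \<in> A}"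
    by (auto simp: doubleton_eq_iff)
  show ?thesis
  proof (cases "finite {w. {v, w} \<in> A}")
    case fin: True
    then have "card {w. {v, w} \<in> insert {a, b} A} \<le> card (insert (if v = a then b else a) {w. {v, w} \<in> A})"
      by (intro card_mono \<open>_ \<subseteq> _\<close>) auto
    with True fin show ?thesis by (simp add: card_insert_if split: if_splits)
  next
    case False
    moreover have "{w. {v, w} \<in> A} \<subseteq> {w. {v, w} \<in> insert {a, b} A}" by auto
    ultimately have "infinite {w. {v, w} \<in> insert {a, b} A}" by (rule infinite_super[rotated])
    then show ?thesis by simp
  qed
next
  case False
  then have "{w. {v, w} \<in> insert {a, b} A} = {w. {v, w} \<in> A}" by (auto simp: doubleton_eq_iff)
  then show ?thesis by simp
qed

lemma finite_comb_V [simp]: "finite (comb_V d L)"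
  by (simp add: comb_V_def)

lemma comb_teeth_subset: "comb_teeth d L \<subseteq> Pow (comb_V d L)"
  by (auto simp: comb_teeth_def)

lemma finite_comb_teeth: "finite (comb_teeth d L)"
  by (rule finite_subset[OF comb_teeth_subset]) simp

lemma comb_teeth_nbrs:
  assumes "A \<subseteq> comb_teeth d L"
  shows "{w. {Row i c, w} \<in> A} = Pt c ` {x. x < d \<and> {Row i c, Pt c x} \<in> A}"
    and "{w. {Pt c x, w} \<in> A} = (\<lambda>i. Row i c) ` {i. i < d \<and> {Row i c, Pt c x} \<in> A}"
proof -
  have "w \<in> Pt c ` {x. x < d \<and> {Row i c, Pt c x} \<in> A}" if w: "{Row i c, w} \<in> A" for w
  proof -
    from w assms have "{Row i c, w} \<in> comb_teeth d L" by blast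
    then show ?thesis using w by (cases rule: comb_teeth_cases) auto
  qed
  then show "{w. {Row i c, w} \<in> A} = Pt c ` {x. x < d \<and> {Row i c, Pt c x} \<in> A}" by auto
  have "w \<in> (\<lambda>i. Row i c) ` {i. i < d \<and> {Row i c, Pt c x} \<in> A}" if w: "{Pt c x, w} \<in> A" for w
  proof -
    from w assms have "{Pt c x, w} \<in> comb_teeth d L" by blast
    then show ?thesis using w by (cases rule: comb_teeth_cases) (auto simp: insert_commute)
  qed
  moreover have "{Pt c x, Row i c} \<in> A" if "{Row i c, Pt c x} \<in> A" for i
    using that by (simp add: insert_commute)
  ultimately show "{w. {Pt c x, w} \<in> A} = (\<lambda>i. Row i c) ` {i. i < d \<and> {Row i c, Pt c x} \<in> A}"
    by auto
qed

lemma comb_rows_nbrs: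
  "finite {w. {v, w} \<in> comb_rows d L} \<and> card {w. {v, w} \<in> comb_rows d L} \<le> 2"
proof -
  obtain a b where "{w. {v, w} \<in> comb_rows d L} \<subseteq> {a, b}"
  proof (cases v)
    case (Row i c)
    then have "{w. {v, w} \<in> comb_rows d L} \<subseteq> {Row i (c - 1), Row i (Suc c)}"
      by (auto elim: comb_rows_cases)
    then show thesis by (rule that)
  next
    case (Pt c x)
    then have "{w. {v, w} \<in> comb_rows d L} \<subseteq> {v, v}" by (auto elim: comb_rows_cases)
    then show thesis by (rule that)
  qed
  note sub = this
  have fin: "finite {a, b}" by simp
  have "card {w. {v, w} \<in> comb_rows d L} \<le> card {a, b}" by (rule card_mono[OF fin sub])
  also have "\<dots> \<le> 2" by (simp add: card_insert_if)
  finally show ?thesis using finite_subset[OF sub fin] by simp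
qed

text \<open>Edges are added as long as both degrees stay below \<open>r\<close> and no short bypass arises; when this
  stops, every column has half of its row vertices or all of its points saturated, because the
  unsaturated ones lie in a common ball.\<close>

lemma exists_dense_teeth:
  assumes "1 \<le> r" "1 \<le> p" "1 \<le> l" and ball: "2 * (4 ^ l * r ^ p) \<le> d"
  obtains A where "A \<subseteq> comb_teeth d L" "no_bypass (comb_rows d L) p l A" "L * (r * d) \<le> 2 * card A"
proof -
  define deg where "deg A v = card {w. {v, w} \<in> A}" for A :: "gvert set set" and v
  define \<A> where "\<A> = {A. A \<subseteq> comb_teeth d L \<and> no_bypass (comb_rows d L) p l A \<and> (\<forall>v. deg A v \<le> r)}"
  have "finite \<A>"
    by (rule finite_subset[of _ "Pow (comb_teeth d L)"]) (auto simp: \<A>_def finite_comb_teeth)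
  moreover have "{} \<in> \<A>" by (simp add: \<A>_def no_bypass_def deg_def)
  \<comment> \<open>An inclusion-maximal member of \<open>\<A>\<close> stands for the result of the
    greedy process.\<close>
  ultimately obtain A where "A \<in> \<A>" and max: "\<And>B. B \<in> \<A> \<Longrightarrow> A \<subseteq> B \<Longrightarrow> A = B"
    using finite_has_maximal[of \<A>] by blast
  then have A: "A \<subseteq> comb_teeth d L" and free: "no_bypass (comb_rows d L) p l A"
    and deg: "\<And>v. deg A v \<le> r" by (auto simp: \<A>_def)
  have finA: "finite A" using A finite_comb_teeth by (rule finite_subset)
  note nbrs = comb_teeth_nbrs[OF A]
  \<comment> \<open>By maximality the tooth between two unsaturated vertices cannot be added, so a
    bypass exists; a tooth already in \<open>A\<close> is such a walk itself.\<close>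
  have near: "mixed_walk (comb_rows d L) A p l (Pt c x) (Row i c)"
    if "L \<le> c" "c < 2 * L" "i < d" "x < d" "deg A (Row i c) < r" "deg A (Pt c x) < r" for c x i
  proof (rule ccontr)
    let ?e = "{Pt c x, Row i c}"
    assume far: "\<not> mixed_walk (comb_rows d L) A p l (Pt c x) (Row i c)"
    have e: "?e \<in> comb_teeth d L"
      using that unfolding comb_teeth_def by (auto simp: insert_commute)
    have "?e \<notin> A"
    proof
      assume "?e \<in> A"
      then have "mixed_walk (comb_rows d L) A 1 1 (Pt c x) (Row i c)"
        by (rule mixed_walk_marked_edge)
      from mixed_walk_mono_length[OF this assms(2,3)] far show False by simp
    qed
    moreover have "deg (insert ?e A) v \<le> r" for v
      using card_nbrs_insert[of v "Pt c x" "Row i c" A] deg[of v] that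
      unfolding deg_def by (auto split: if_splits)
    then have "insert ?e A \<in> \<A>"
      using no_bypass_insert[OF free far] A e by (simp add: \<A>_def)
    ultimately show False using max[of "insert ?e A"] by blast
  qed
  define E where "E c = {e \<in> A. \<exists>i x. e = {Row i c, Pt c x}}" for c
  have finE: "finite (E c)" for c using finA by (simp add: E_def)
  have deg_Row: "deg A (Row i c) = card {x. x < d \<and> {Row i c, Pt c x} \<in> A}" for i c
    unfolding deg_def nbrs(1) by (rule card_image) (simp add: inj_on_def)
  have deg_Pt: "deg A (Pt c x) = card {i. i < d \<and> {Row i c, Pt c x} \<in> A}" for x c
    unfolding deg_def nbrs(2) by (rule card_image) (simp add: inj_on_def)
  have sum_Row: "(\<Sum>i<d. deg A (Row i c)) \<le> card (E c)" for c
  proof -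
    have "(\<Sum>i<d. deg A (Row i c)) = card (SIGMA i:{..<d}. {x. x < d \<and> {Row i c, Pt c x} \<in> A})"
      by (simp add: deg_Row)
    also have "\<dots> \<le> card (E c)"
      by (rule card_inj_on_le[of "\<lambda>(i, x). {Row i c, Pt c x}"])
        (auto simp: inj_on_def doubleton_eq_iff E_def finA)
    finally show ?thesis .
  qed
  have sum_Pt: "(\<Sum>x<d. deg A (Pt c x)) \<le> card (E c)" for c
  proof -
    have "(\<Sum>x<d. deg A (Pt c x)) = card (SIGMA x:{..<d}. {i. i < d \<and> {Row i c, Pt c x} \<in> A})"
      by (simp add: deg_Pt)
    also have "\<dots> \<le> card (E c)"
      by (rule card_inj_on_le[of "\<lambda>(x, i). {Row i c, Pt c x}"])
        (auto simp: inj_on_def doubleton_eq_iff E_def finA)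
    finally show ?thesis .
  qed
  have column: "r * d \<le> 2 * card (E c)" if c: "L \<le> c" "c < 2 * L" for c
  proof (cases "\<exists>x<d. deg A (Pt c x) < r")
    case True
    \<comment> \<open>A single unsaturated point has all unsaturated row vertices of its column in
      its ball, hence at most half of the rows.\<close>
    then obtain x where x: "x < d" "deg A (Pt c x) < r" by blast
    define U where "U = {i. i < d \<and> deg A (Row i c) < r}"
    have fin: "finite {w. {v, w} \<in> A}" for v
    proof (rule finite_subset)
      have "A \<subseteq> Pow (comb_V d L)" using A comb_teeth_subset by (rule order_trans)
      then show "{w. {v, w} \<in> A} \<subseteq> comb_V d L" by blast
    qed simp
    have ball': "finite {v. mixed_walk (comb_rows d L) A p l (Pt c x) v} \<and>
        card {v. mixed_walk (comb_rows d L) A p l (Pt c x) v} \<le> 4 ^ l * r ^ p"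
      using comb_rows_nbrs deg assms(1) fin unfolding deg_def
      by (intro card_mixed_walk conjI) simp_all
    have "card U \<le> card {v. mixed_walk (comb_rows d L) A p l (Pt c x) v}"
      using ball' near[OF c _ x(1) _ x(2)]
      by (intro card_inj_on_le[of "\<lambda>i. Row i c"]) (auto simp: U_def inj_on_def)
    with ball' ball have "2 * card U \<le> d" by linarith
    moreover have "card ({..<d} - U) = d - card U"
      by (subst card_Diff_subset) (auto simp: U_def)
    ultimately have "d \<le> 2 * card ({..<d} - U)" by linarith
    then have "r * d \<le> 2 * (card ({..<d} - U) * r)" by simp
    also have "card ({..<d} - U) * r \<le> (\<Sum>i\<in>{..<d} - U. deg A (Row i c))"
    proof -
      have "r \<le> deg A (Row i c)" if "i \<in> {..<d} - U" for i using that by (auto simp: U_def)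
      from sum_bounded_below[of "{..<d} - U", OF this] show ?thesis by simp
    qed
    also have "\<dots> \<le> (\<Sum>i<d. deg A (Row i c))" by (rule sum_mono2) auto
    also have "\<dots> \<le> card (E c)" by (rule sum_Row)
    finally show ?thesis by simp
  next
    case False
    then have "r \<le> deg A (Pt c x)" if "x \<in> {..<d}" for x using that by force
    from sum_bounded_below[of "{..<d}", OF this] have "d * r \<le> (\<Sum>x<d. deg A (Pt c x))" by simp
    with sum_Pt[of c] show ?thesis by (simp add: mult.commute)
  qed
  have "L * (r * d) \<le> (\<Sum>c\<in>{L..<2 * L}. 2 * card (E c))"
    using sum_bounded_below[of "{L..<2 * L}" "r * d" "\<lambda>c. 2 * card (E c)"] column by simp
  also have "\<dots> = 2 * (\<Sum>c\<in>{L..<2 * L}. card (E c))" by (simp add: sum_distrib_left)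
  also have "(\<Sum>c\<in>{L..<2 * L}. card (E c)) = card (\<Union>c\<in>{L..<2 * L}. E c)"
    by (rule card_UN_disjoint[symmetric]) (simp, simp add: finE, auto simp: E_def doubleton_eq_iff)
  also have "\<dots> \<le> card A" by (rule card_mono[OF finA]) (auto simp: E_def)
  finally have "L * (r * d) \<le> 2 * card A" by simp
  with A free show thesis by (rule that)
qed

section \<open>Teeth that cannot be left out\<close>

lemma comb_walk:
  assumes "i < d" "c < 2 * L"
  shows "walk (comb_rows d L) c (Row i 0) (Row i c)"
  using assms(2)
proof (induction c)
  case (Suc c)
  then have "{Row i c, Row i (Suc c)} \<in> comb_rows d L"
    using assms unfolding comb_rows_def by blast
  from walk.step[OF Suc.IH this] Suc.prems show ?case by simp
qed simp

primrec column :: "gvert \<Rightarrow> nat" where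
  "column (Row i c) = c"
| "column (Pt c x) = c"

text \<open>Teeth stay within their column, so a walk from column 0 spends at least
  \<open>column v\<close> edges on rows; only the others can be teeth.\<close>

lemma comb_mixed_walk:
  assumes "walk (comb_rows d L \<union> A) m (Row i 0) v" "A \<subseteq> comb_teeth d L"
  shows "column v \<le> m \<and> mixed_walk (comb_rows d L) A (m - column v) m (Row i 0) v"
  using assms(1)
proof (induction m "Row i 0" v rule: walk.induct)
  case (step m v w)
  then have le: "column v \<le> m" and v: "mixed_walk (comb_rows d L) A (m - column v) m (Row i 0) v"
    by auto
  show ?case
  proof (cases "{v, w} \<in> comb_rows d L")
    case True
    then have col: "column w \<le> Suc (column v)" "column v \<le> Suc (column w)"
      by (auto elim: comb_rows_cases)
    from mixed_walk_mono_length[OF mixed_walk.plain[OF v True], of "Suc m - column w" "Suc m"] col le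
    show ?thesis by simp
  next
    case False
    with step.hyps(3) have vw: "{v, w} \<in> A" by simp
    with assms(2) have "{v, w} \<in> comb_teeth d L" by blast
    then have "column w = column v" by (cases rule: comb_teeth_cases) auto
    with mixed_walk.marked[OF v vw] le show ?thesis by (simp add: Suc_diff_le)
  qed
qed simp

text \<open>If a tooth in column \<open>c\<close> were missing, a walk in \<open>F\<close> with
  \<open>c + 1 + L\<close> edges would reach its point using at most \<open>L + 1\<close> teeth.
  Preceded by the way back along row \<open>i\<close> to the port, it bypasses the tooth with
  \<open>2 * c + 1 + L\<close> edges, fewer than \<open>5 * L\<close> since
  \<open>c < 2 * L\<close>.\<close>

lemma comb_card:
  assumes A: "A \<subseteq> comb_teeth d L" "no_bypass (comb_rows d L) (L + 1) (5 * L) A" and "0 < L"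
    and sub: "F \<subseteq> comb_rows d L \<union> A"
    and short: "\<And>i w. i < d \<Longrightarrow> w \<in> comb_V d L \<Longrightarrow>
      walk (comb_rows d L \<union> A) (comb_depth w) (Row i 0) w \<Longrightarrow> walk F (comb_depth w + L) (Row i 0) w"
  shows "card A \<le> card F"
proof (rule card_mono)
  have "comb_rows d L \<union> A \<subseteq> Pow (comb_V d L)"
    using gadget.graph[OF gadget_comb[OF A(1) \<open>0 < L\<close>]] by (auto simp: simple_graph_def)
  with sub show "finite F" by (meson finite_Pow_iff finite_comb_V finite_subset)
  show "A \<subseteq> F"
  proof
    fix e assume e: "e \<in> A"
    with A(1) obtain i c x where ex: "e = {Row i c, Pt c x}" "i < d" "L \<le> c" "c < 2 * L" "x < d"
      unfolding comb_teeth_def by blast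
    show "e \<in> F"
    proof (rule ccontr)
      assume "e \<notin> F"
      with sub have sub': "F \<subseteq> comb_rows d L \<union> (A - {e})" by blast
      have row: "walk (comb_rows d L) c (Row i 0) (Row i c)" using ex by (intro comb_walk)
      have "walk (comb_rows d L \<union> A) c (Row i 0) (Row i c)" by (rule walk_mono_edges[OF row]) simp
      moreover have "{Row i c, Pt c x} \<in> comb_rows d L \<union> A" using e ex by simp
      ultimately have "walk (comb_rows d L \<union> A) (Suc c) (Row i 0) (Pt c x)" by (rule walk.step)
      then have "walk F (c + 1 + L) (Row i 0) (Pt c x)" using short[of i "Pt c x"] ex by simp
      from comb_mixed_walk[OF walk_mono_edges[OF this sub']] A(1)
      have there: "mixed_walk (comb_rows d L) (A - {e}) (L + 1) (c + 1 + L) (Row i 0) (Pt c x)"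
        by auto
      have "walk (comb_rows d L \<union> {}) c (Row i 0) (Row i c)" using row by simp
      from comb_mixed_walk[OF this]
      have "mixed_walk (comb_rows d L) {} 0 c (Row i 0) (Row i c)" by simp
      from mixed_walk_sym[OF mixed_walk_mono_edges[OF this]]
      have return: "mixed_walk (comb_rows d L) (A - {e}) 0 c (Row i c) (Row i 0)" by blast
      have "mixed_walk (comb_rows d L) (A - {e}) (L + 1) (5 * L) (Row i c) (Pt c x)"
        by (rule mixed_walk_mono_length[OF mixed_walk_trans[OF there return]]) (use ex in auto)
      with A(2) e show False unfolding no_bypass_def ex(1) by blast
    qed
  qed
qed

subsection \<open>The resulting bounds\<close>

lemma star_lower_bound:
  fixes n :: nat
  defines "E \<equiv> (\<lambda>v. {0, v}) ` {1..<n}"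
  assumes ft: "ft_walk b {..<n} E 0 H" and "3 \<le> n"
  shows "n - 1 \<le> card H"
proof -
  have inj: "inj_on (\<lambda>v. {0, v}) {1..<n}" by (auto simp: inj_on_def doubleton_eq_iff)
  have "E \<subseteq> H"
  proof
    fix e assume "e \<in> E"
    then obtain v where v: "1 \<le> v" "v < n" "e = {0, v}" by (auto simp: E_def)
    \<comment> \<open>The edge of another leaf fails, so \<open>v\<close> stays adjacent to the
      centre in the host graph.\<close>
    define u :: nat where "u = (if v = 1 then 2 else 1)"
    have u: "1 \<le> u" "u < n" "u \<noteq> v" using \<open>3 \<le> n\<close> by (auto simp: u_def)
    then have "{0, v} \<in> E - {{0, u}}" using v by (auto simp: E_def doubleton_eq_iff)
    then have "walk (E - {{0, u}}) (Suc 0) 0 v" by (rule walk_edge)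
    moreover have "{0, u} \<in> E" "v \<in> {..<n}" using u v by (auto simp: E_def)
    ultimately have "walk (H - {{0, u}}) (Suc 0 + b) 0 v"
      using ft unfolding ft_walk_def by blast
    then obtain w where w: "{w, v} \<in> H"
      by cases (use v in auto)
    with ft have "{w, v} \<in> E" by (auto simp: ft_walk_def)
    then have "{w, v} = e" using v by (auto simp: E_def doubleton_eq_iff)
    with w show "e \<in> H" by simp
  qed
  moreover have "finite H"
    using ft by (auto simp: ft_walk_def E_def intro: finite_subset)
  ultimately have "card E \<le> card H" by (intro card_mono)
  then show ?thesis by (simp only: E_def card_image[OF inj] card_atLeastLessThan)
qed

definition ft_lower_bound :: "nat \<Rightarrow> real \<Rightarrow> real \<Rightarrow> bool" where
  "ft_lower_bound n \<beta> K \<longleftrightarrow> (\<exists>(V::nat set) E s. simple_graph V E \<and> card V = n \<and> s \<in> V \<and>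
     (\<forall>H. ft_abfs 1 \<beta> V E s H \<longrightarrow> K \<le> real (card H)))"

lemma ft_lower_bound_mono: "ft_lower_bound n \<beta> K \<Longrightarrow> K' \<le> K \<Longrightarrow> ft_lower_bound n \<beta> K'"
  unfolding ft_lower_bound_def by (elim ex_forward conj_forward all_forward imp_forward) auto

lemma ft_lower_boundI:
  fixes V :: "'a set"
  assumes "simple_graph V E" "s \<in> V" "card V \<le> n" "\<beta> \<le> real b"
    and "\<And>H. ft_walk b V E s H \<Longrightarrow> K \<le> card H"
  shows "ft_lower_bound n \<beta> (real K)"
  using transfer_lower_bound[OF assms] unfolding ft_lower_bound_def of_nat_le_iff .

lemma ft_lower_bound_star:
  assumes "3 \<le> n" "\<beta> \<le> real b"
  shows "ft_lower_bound n \<beta> (real (n - 1))"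
proof (rule ft_lower_boundI)
  show "simple_graph {..<n} ((\<lambda>v. {0, v}) ` {1..<n})" by (auto simp: simple_graph_def)
  show "0 \<in> {..<n}" "card {..<n} \<le> n" using assms by auto
  show "n - 1 \<le> card H" if "ft_walk b {..<n} ((\<lambda>v. {0, v}) ` {1..<n}) 0 H" for H
    using star_lower_bound[OF that assms(1)] .
qed (rule assms(2))

text \<open>The term \<open>2 * (b + 3) * d\<^sup>2\<close> bounds the number of vertices on the
  path and the rows; the rest is for the \<open>M\<close> copies.\<close>

lemma (in gadget) ft_lower_bound_gadget:
  assumes "0 < d" "2 * (b + 3) * d\<^sup>2 + M * card W \<le> n" "\<beta> \<le> real b"
    and "\<And>F'. F' \<subseteq> F \<Longrightarrow>
      (\<And>i w. i < d \<Longrightarrow> w \<in> W \<Longrightarrow> walk F (depth w) (port i) w \<Longrightarrow>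
         walk F' (depth w + b) (port i) w) \<Longrightarrow> K \<le> card F'"
  shows "ft_lower_bound n \<beta> (real (M * K))"
proof (rule ft_lower_boundI[OF simple_graph_skel])
  show "R 0 0 \<in> skel_V M" by (simp add: skel_V_intros)
  have "(d + 1) * (d * (b + 2) + 1) \<le> (2 * d) * (d * (b + 2) + d)"
    using assms(1) by (intro mult_mono) auto
  also have "\<dots> = 2 * (b + 3) * d\<^sup>2" by (simp add: algebra_simps power2_eq_square)
  finally show "card (skel_V M) \<le> n" using card_skel_V[of M] assms(2) by linarith
  show "M * K \<le> card H" if "ft_walk b (skel_V M) (skel_E M) (R 0 0) H" for H
    using ft_walk_skel_card[OF that assms(4)] .
qed (rule assms(3))

text \<open>There are as many copies as ports, so that for fixed \<open>k\<close> rows and copies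
  both take on the order of \<open>(q ^ k)\<^sup>2\<close> vertices.\<close>

lemma ft_lower_bound_butterfly:
  assumes k: "0 < k" and q: "0 < q" and n: "(6 * k + 5) * (q ^ k)\<^sup>2 \<le> n" and "\<beta> \<le> real (2 * k - 1)"
  shows "ft_lower_bound n \<beta> (real (q ^ (2 * k + 1)))"
proof -
  have "q ^ k * card (butterfly_V q k) \<le> q ^ k * ((2 * k + 1) * q ^ k)"
    by (intro mult_left_mono card_butterfly_V) simp
  also have "\<dots> = (2 * k + 1) * (q ^ k)\<^sup>2" by (simp add: power2_eq_square algebra_simps)
  finally have "2 * (2 * k - 1 + 3) * (q ^ k)\<^sup>2 + q ^ k * card (butterfly_V q k)
      \<le> (2 * (2 * k - 1 + 3) + (2 * k + 1)) * (q ^ k)\<^sup>2"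
    unfolding add_mult_distrib by linarith
  also have "2 * (2 * k - 1 + 3) + (2 * k + 1) = 6 * k + 5" using k by simp
  finally have size: "2 * (2 * k - 1 + 3) * (q ^ k)\<^sup>2 + q ^ k * card (butterfly_V q k) \<le> n"
    using n by linarith
  have "ft_lower_bound n \<beta> (real (q ^ k * q ^ (k + 1)))"
    by (rule gadget.ft_lower_bound_gadget[OF gadget_butterfly[OF k] _ size assms(4)])
      (use q butterfly_card[OF k q] in auto)
  moreover have "q ^ k * q ^ (k + 1) = q ^ (2 * k + 1)" by (simp add: mult_2 power_add)
  ultimately show ?thesis by (simp only:)
qed

text \<open>The hypothesis on \<open>d\<close> says that balls for the budgets \<open>b + 1\<close>
  and \<open>5 * b\<close> cover at most half of the rows.\<close>

lemma ft_lower_bound_comb: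
  assumes b: "0 < b" and r: "1 \<le> r" and d: "2 * (4 ^ (5 * b) * r ^ (b + 1)) \<le> d"
    and n: "(5 * b + 6) * d\<^sup>2 \<le> n" and "\<beta> \<le> real b"
  shows "ft_lower_bound n \<beta> (real (b * r * d\<^sup>2) / 2)"
proof -
  obtain A where A: "A \<subseteq> comb_teeth d b" "no_bypass (comb_rows d b) (b + 1) (5 * b) A"
    and large: "b * (r * d) \<le> 2 * card A"
    using exists_dense_teeth[OF r _ _ d, of b] b by auto
  have "d * card (comb_V d b) \<le> d * (3 * b * d)" by (intro mult_left_mono card_comb_V) simp
  also have "\<dots> = 3 * b * d\<^sup>2" by (simp add: power2_eq_square)
  finally have "2 * (b + 3) * d\<^sup>2 + d * card (comb_V d b) \<le> (2 * (b + 3) + 3 * b) * d\<^sup>2"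
    unfolding add_mult_distrib by linarith
  also have "2 * (b + 3) + 3 * b = 5 * b + 6" by simp
  finally have size: "2 * (b + 3) * d\<^sup>2 + d * card (comb_V d b) \<le> n" using n by linarith
  have "0 < 2 * (4 ^ (5 * b) * r ^ (b + 1))" using r by simp
  with d have "0 < d" by linarith
  then have "ft_lower_bound n \<beta> (real (d * card A))"
    by (rule gadget.ft_lower_bound_gadget[OF gadget_comb[OF A(1) b] _ size assms(5) comb_card[OF A b]])
  moreover have "real (b * r * d\<^sup>2) / 2 \<le> real (d * card A)"
  proof -
    have "d * (b * (r * d)) \<le> d * (2 * card A)" using large by (rule mult_left_mono) simp
    then have "b * r * d\<^sup>2 \<le> 2 * (d * card A)" by (simp add: power2_eq_square algebra_simps)
    then show ?thesis by linarith
  qed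
  ultimately show ?thesis by (rule ft_lower_bound_mono)
qed

section \<open>Choice of the parameters\<close>

lemma nat_floor_ge_half:
  fixes x :: real
  assumes "1 \<le> x"
  shows "real (nat \<lfloor>x\<rfloor>) \<le> x" "x \<le> 2 * real (nat \<lfloor>x\<rfloor>)" "1 \<le> nat \<lfloor>x\<rfloor>"
proof -
  have "1 \<le> \<lfloor>x\<rfloor>" using assms by simp
  then have "real (nat \<lfloor>x\<rfloor>) = of_int \<lfloor>x\<rfloor>" "1 \<le> real_of_int \<lfloor>x\<rfloor>" by auto
  then show "real (nat \<lfloor>x\<rfloor>) \<le> x" "x \<le> 2 * real (nat \<lfloor>x\<rfloor>)" by linarith+
  show "1 \<le> nat \<lfloor>x\<rfloor>" using \<open>1 \<le> \<lfloor>x\<rfloor>\<close> by linarith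
qed

lemma ft_lower_bound_constant:
  assumes k: "0 < k"
  shows "\<exists>c>0. \<forall>n\<ge>6 * k + 5. \<forall>\<beta>\<le>real (2 * k - 1).
    ft_lower_bound n \<beta> (c * real n powr (1 + 1 / real (2 * k)))"
proof (intro exI conjI allI impI)
  define N where "N = real (6 * k + 5)"
  have N: "1 \<le> N" by (simp add: N_def)
  \<comment> \<open>One \<open>N\<close> comes from \<open>n = N * x ^ (2 * k)\<close>, the other
    bounds the root of \<open>N\<close>, and the power of two pays for rounding \<open>x\<close>
    down to \<open>q\<close>.\<close>
  let ?c = "1 / (N\<^sup>2 * 2 ^ (2 * k + 1))"
  show "0 < ?c" using N by simp
  fix n :: nat and \<beta> :: real
  assume n: "6 * k + 5 \<le> n" and \<beta>: "\<beta> \<le> real (2 * k - 1)"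
  define x where "x = (real n / N) powr (1 / real (2 * k))"
  define q where "q = nat \<lfloor>x\<rfloor>"
  have nN: "1 \<le> real n / N" using n N by (simp add: N_def)
  then have x1: "1 \<le> x" unfolding x_def by (intro ge_one_powr_ge_zero) auto
  have xk: "x ^ (2 * k) = real n / N"
  proof -
    have "x ^ (2 * k) = x powr real (2 * k)" using x1 by (intro powr_realpow[symmetric]) simp
    also have "\<dots> = real n / N" unfolding x_def powr_powr using nN k N by simp
    finally show ?thesis .
  qed
  have q: "real q \<le> x" "x \<le> 2 * real q" "0 < q"
    using nat_floor_ge_half[OF x1] unfolding q_def by auto
  have "real ((6 * k + 5) * (q ^ k)\<^sup>2) = N * real q ^ (2 * k)"
    by (simp add: N_def mult.commute flip: power_mult)
  also have "\<dots> \<le> N * x ^ (2 * k)" using q N by (intro mult_left_mono power_mono) auto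
  also have "\<dots> = real n" using xk N by simp
  finally have "(6 * k + 5) * (q ^ k)\<^sup>2 \<le> n" by linarith
  note lower = ft_lower_bound_butterfly[OF k q(3) this \<beta>]
  have "real n powr (1 / real (2 * k)) = N powr (1 / real (2 * k)) * x"
    unfolding x_def using N nN by (subst powr_mult[symmetric]) auto
  also have "N powr (1 / real (2 * k)) \<le> N powr 1" using N k by (intro powr_mono) auto
  finally have "real n powr (1 / real (2 * k)) \<le> N * x" using N x1 by (simp add: mult_right_mono)
  moreover have "real n = N * x ^ (2 * k)" using xk N by simp
  ultimately have "real n powr (1 + 1 / real (2 * k)) \<le> (N * x ^ (2 * k)) * (N * x)"
    using n by (simp add: powr_add mult_left_mono)
  also have "\<dots> = N\<^sup>2 * x ^ (2 * k + 1)" by (simp add: power2_eq_square)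
  also have "\<dots> \<le> N\<^sup>2 * (2 * real q) ^ (2 * k + 1)" using q x1 by (intro mult_left_mono power_mono) auto
  finally have "real n powr (1 + 1 / real (2 * k)) \<le> N\<^sup>2 * 2 ^ (2 * k + 1) * real (q ^ (2 * k + 1))"
    by (simp add: power_mult_distrib mult_ac)
  then have "?c * real n powr (1 + 1 / real (2 * k)) \<le> real (q ^ (2 * k + 1))"
    using N by (simp add: field_simps)
  with lower show "ft_lower_bound n \<beta> (?c * real n powr (1 + 1 / real (2 * k)))"
    by (rule ft_lower_bound_mono)
qed

lemma ft_lower_bound_growing:
  assumes b: "3 \<le> b" and n: "3 \<le> n" and \<beta>: "\<beta> \<le> real b"
  shows "ft_lower_bound n \<beta> (1 / 229376 * real n powr (1 + 1 / (2 * (real b + 3))))"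
proof -
  define y where "y = real n powr (1 / (2 * (real b + 3)))"
  have y1: "1 \<le> y" unfolding y_def using n by (intro ge_one_powr_ge_zero) auto
  have yn: "(y ^ (b + 3))\<^sup>2 = real n"
  proof -
    have "(y ^ (b + 3))\<^sup>2 = y ^ (2 * (b + 3))" by (simp add: mult.commute flip: power_mult)
    also have "\<dots> = y powr real (2 * (b + 3))" using y1 by (simp only: powr_realpow)
    also have "\<dots> = real n" unfolding y_def using n by (simp add: powr_powr)
    finally show ?thesis .
  qed
  have goal: "1 / 229376 * real n powr (1 + 1 / (2 * (real b + 3))) = real n * y / 229376"
    using n by (simp add: powr_add y_def)
  show ?thesis
  \<comment> \<open>While \<open>y\<close> is bounded, a linear number of edges is enough, and a
    star provides it.\<close>
  proof (cases "y < 2048")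
    case True
    have "real n * y / 229376 \<le> real n * 2048 / 229376" using True by (intro divide_right_mono mult_left_mono) auto
    also have "\<dots> \<le> real (n - 1)" using n by (simp add: of_nat_diff)
    finally show ?thesis
      unfolding goal using ft_lower_bound_star[OF n \<beta>] ft_lower_bound_mono by blast
  next
    case False
    \<comment> \<open>In \<open>2048 = 2 * 1024\<close>, the powers of 1024 pay for
      \<open>4 ^ (5 * b)\<close> and the powers of 2 for the factor \<open>b\<close> lost between
      \<open>d\<close> and the root of \<open>n\<close>.\<close>
    define r where "r = nat \<lfloor>y / 2048\<rfloor>"
    have r: "2048 * real r \<le> y" "y \<le> 4096 * real r" "1 \<le> r"
      using nat_floor_ge_half[of "y / 2048"] False unfolding r_def by auto
    have "b < 2 ^ b" by (rule less_exp)
    then have b2: "real b \<le> 2 ^ b" by (metis less_imp_le of_nat_le_iff of_nat_numeral of_nat_power)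
    \<comment> \<open>The 7 comes from \<open>5 * b + 6 \<le> 7 * b\<close>, valid for
      \<open>3 \<le> b\<close>.\<close>
    define z where "z = sqrt (real n / (7 * real b))"
    have z2: "7 * real b * z\<^sup>2 = real n" unfolding z_def using b by simp
    have "2048 * real b \<le> y ^ (b + 3)"
    proof -
      have "2048 * real b \<le> 2048 ^ 1 * 2048 ^ b"
        using b2 power_mono[of 2 "2048::real" b] by simp
      also have "\<dots> \<le> 2048 ^ (b + 3)" unfolding power_add[symmetric] by (rule power_increasing) auto
      also have "\<dots> \<le> y ^ (b + 3)" using False by (intro power_mono) auto
      finally show ?thesis .
    qed
    then have "(2048 * real b)\<^sup>2 \<le> real n" unfolding yn[symmetric] by (intro power_mono) auto
    moreover have "7 * real b \<le> (2048 * real b)\<^sup>2" using b by (simp add: power2_eq_square)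
    ultimately have z1: "1 \<le> z" unfolding z_def using b by simp
    define d where "d = nat \<lfloor>z\<rfloor>"
    have d: "real d \<le> z" "z \<le> 2 * real d" "1 \<le> d"
      using nat_floor_ge_half[OF z1] unfolding d_def by auto
    have "real ((5 * b + 6) * d\<^sup>2) \<le> 7 * real b * z\<^sup>2"
      unfolding of_nat_mult of_nat_power using b d by (intro mult_mono power_mono) auto
    then have size: "(5 * b + 6) * d\<^sup>2 \<le> n" using z2 by linarith
    have "z\<^sup>2 \<le> (2 * real d)\<^sup>2" using d z1 by (intro power_mono) auto
    then have n_le: "real n \<le> 28 * real b * (real d)\<^sup>2"
      using z2 mult_left_mono[of "z\<^sup>2" "(2 * real d)\<^sup>2" "7 * real b"] by (simp add: power_mult_distrib)
    also have "\<dots> \<le> (28 * real b)\<^sup>2 * (real d)\<^sup>2"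
      using b by (intro mult_right_mono) (simp_all add: power2_eq_square)
    finally have "(y ^ (b + 3))\<^sup>2 \<le> (28 * real b * real d)\<^sup>2" by (simp add: yn power_mult_distrib)
    then have "y ^ (b + 3) \<le> 28 * real b * real d" by (rule power2_le_imp_le) simp
    moreover have "2048 * real b * (1024 ^ b * real r ^ (b + 1)) \<le> y ^ (b + 3)"
    proof -
      have "2048 * real b * (1024 ^ b * real r ^ (b + 1)) \<le> 2048 * 2 ^ b * (1024 ^ b * real r ^ (b + 1))"
        using b2 by (intro mult_right_mono mult_left_mono) auto
      also have "\<dots> = 2048 * (2 * 1024) ^ b * real r ^ (b + 1)" by (simp only: power_mult_distrib mult_ac)
      also have "\<dots> = (2048 * real r) ^ (b + 1)" by (simp add: power_mult_distrib)
      also have "\<dots> \<le> y ^ (b + 1)" using r by (intro power_mono) auto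
      also have "\<dots> \<le> y ^ (b + 3)" using y1 by (intro power_increasing) auto
      finally show ?thesis .
    qed
    ultimately have "real b * (2048 * (1024 ^ b * real r ^ (b + 1))) \<le> real b * (28 * real d)"
      by (simp add: algebra_simps)
    then have "2048 * (1024 ^ b * real r ^ (b + 1)) \<le> 28 * real d"
      using b by (subst (asm) mult_le_cancel_left_pos) auto
    then have "2 * (1024 ^ b * real r ^ (b + 1)) \<le> real d"
      using zero_le_mult_iff[of "1024 ^ b" "real r ^ (b + 1)"] by linarith
    then have "real (2 * (4 ^ (5 * b) * r ^ (b + 1))) \<le> real d" by (simp add: power_mult)
    then have ball: "2 * (4 ^ (5 * b) * r ^ (b + 1)) \<le> d" by linarith
    have "ft_lower_bound n \<beta> (real (b * r * d\<^sup>2) / 2)"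
      using b by (intro ft_lower_bound_comb[OF _ r(3) ball size \<beta>]) simp
    \<comment> \<open>Here \<open>229376 = 2 * 28 * 4096\<close>: the halving in the bound, the loss
      in \<open>d\<close> and the loss in \<open>r\<close>.\<close>
    moreover have "real n * y / 229376 \<le> real (b * r * d\<^sup>2) / 2"
    proof -
      have "real n * y \<le> (28 * real b * (real d)\<^sup>2) * (4096 * real r)"
        using n_le r y1 by (intro mult_mono) auto
      then show ?thesis by (simp add: field_simps)
    qed
    ultimately show ?thesis unfolding goal by (rule ft_lower_bound_mono)
  qed
qed

theorem theorem4:
  "\<forall>C>0::real. \<exists>c>0::real. \<exists>n\<^sub>0::nat. \<forall>n\<ge>n\<^sub>0. \<forall>\<beta>::int.
     \<exists>(V::nat set) (E::nat set set) (s::nat).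
       simple_graph V E \<and> card V = n \<and> s \<in> V \<and>
       (\<forall>H. ft_abfs 1 (real_of_int \<beta>) V E s H \<longrightarrow>
          (\<beta> \<le> 3 \<longrightarrow> real (card H) \<ge> c * real n powr (5/4)) \<and>
          (4 \<le> \<beta> \<and> real_of_int \<beta> \<le> C * ln (real n) \<longrightarrow>
             real (card H) \<ge> c * real n powr (1 + 1 / (2 * (real_of_int \<beta> + 3)))) \<and>
          (\<beta> \<le> 5 \<longrightarrow> real (card H) \<ge> c * real n powr (7/6)) \<and>
          (\<beta> \<le> 9 \<longrightarrow> real (card H) \<ge> c * real n powr (11/10)))"
proof (intro allI impI, goal_cases)
  case (1 C)
  have const: "\<exists>c>0. \<forall>n\<ge>6 * k + 5. \<forall>\<beta>\<le>real (2 * k - 1).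
      ft_lower_bound n \<beta> (c * real n powr (1 + 1 / real (2 * k)))" if "0 < k" for k
    using ft_lower_bound_constant[OF that] .
  \<comment> \<open>The values \<open>k = 2, 3, 5\<close> give the slacks
    \<open>2 * k - 1 = 3, 5, 9\<close> and the thresholds
    \<open>6 * k + 5 = 17, 23, 35\<close>.\<close>
  obtain c2 c3 c5 :: real where c: "0 < c2" "0 < c3" "0 < c5"
    and c2: "\<And>n \<beta>. 17 \<le> n \<Longrightarrow> \<beta> \<le> 3 \<Longrightarrow> ft_lower_bound n \<beta> (c2 * real n powr (5/4))"
    and c3: "\<And>n \<beta>. 23 \<le> n \<Longrightarrow> \<beta> \<le> 5 \<Longrightarrow> ft_lower_bound n \<beta> (c3 * real n powr (7/6))"
    and c5: "\<And>n \<beta>. 35 \<le> n \<Longrightarrow> \<beta> \<le> 9 \<Longrightarrow> ft_lower_bound n \<beta> (c5 * real n powr (11/10))"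
    using const[of 2] const[of 3] const[of 5] by auto
  define c where "c = min (min c2 c3) (min c5 (1 / 229376))"
  have c_le: "0 < c" "c \<le> c2" "c \<le> c3" "c \<le> c5" "c \<le> 1 / 229376" using c by (auto simp: c_def)
  show ?case
  proof (intro exI[of _ c] exI[of _ "35::nat"] conjI allI impI, goal_cases)
    case (2 n \<beta>)
    then have n: "35 \<le> n" .
    \<comment> \<open>At least as large as every exponent demanded for this \<beta>, so that one
      graph serves all four claims.\<close>
    define best where "best = (if \<beta> \<le> 3 then 5/4 else if \<beta> \<le> 5 then 7/6
      else if \<beta> \<le> 9 then 11/10 else 1 + 1 / (2 * (real_of_int \<beta> + 3)))"
    have "ft_lower_bound n (real_of_int \<beta>) (c * real n powr best)"
    proof -
      have weaken: "ft_lower_bound n (real_of_int \<beta>) (c * real n powr x)"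
        if "ft_lower_bound n (real_of_int \<beta>) (c' * real n powr x)" "c \<le> c'" for c' x
        by (rule ft_lower_bound_mono[OF that(1)]) (use that(2) in \<open>simp add: mult_right_mono\<close>)
      consider "\<beta> \<le> 3" | "3 < \<beta>" "\<beta> \<le> 5" | "5 < \<beta>" "\<beta> \<le> 9" | "9 < \<beta>" by linarith
      then show ?thesis
      proof cases
        case 1
        then have "ft_lower_bound n (real_of_int \<beta>) (c2 * real n powr best)"
          using c2[of n "real_of_int \<beta>"] n by (simp add: best_def)
        then show ?thesis using c_le(2) by (rule weaken)
      next
        case 2
        then have "ft_lower_bound n (real_of_int \<beta>) (c3 * real n powr best)"
          using c3[of n "real_of_int \<beta>"] n by (simp add: best_def)
        then show ?thesis using c_le(3) by (rule weaken)
      next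
        case 3
        then have "ft_lower_bound n (real_of_int \<beta>) (c5 * real n powr best)"
          using c5[of n "real_of_int \<beta>"] n by (simp add: best_def)
        then show ?thesis using c_le(4) by (rule weaken)
      next
        case 4
        then have "ft_lower_bound n (real_of_int \<beta>) (1 / 229376 * real n powr best)"
          using ft_lower_bound_growing[of "nat \<beta>" n "real_of_int \<beta>"] n by (simp add: best_def)
        then show ?thesis using c_le(5) by (rule weaken)
      qed
    qed
    then obtain V E s where G: "simple_graph (V :: nat set) E" "card V = n" "s \<in> V"
      and H: "\<And>H. ft_abfs 1 (real_of_int \<beta>) V E s H \<Longrightarrow> c * real n powr best \<le> real (card H)"
      unfolding ft_lower_bound_def by blast
    have small: "c * real n powr x \<le> real (card H)"
      if "ft_abfs 1 (real_of_int \<beta>) V E s H" "x \<le> best" for x H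
    proof -
      have "c * real n powr x \<le> c * real n powr best"
        using n c_le that by (intro mult_left_mono powr_mono) auto
      with H[OF that(1)] show ?thesis by linarith
    qed
    \<comment> \<open>So for \<beta> from 4 to 9 the exponent of the second claim is at most
      \<open>11/10\<close> and hence covered by \<open>best\<close>.\<close>
    have "1 / (2 * (real_of_int \<beta> + 3)) \<le> 1 / 10" if "4 \<le> \<beta>"
      using that by (intro divide_left_mono) auto
    then have best:
      "\<beta> \<le> 3 \<Longrightarrow> 5/4 \<le> best" "\<beta> \<le> 5 \<Longrightarrow> 7/6 \<le> best" "\<beta> \<le> 9 \<Longrightarrow> 11/10 \<le> best"
      "4 \<le> \<beta> \<and> real_of_int \<beta> \<le> C * ln (real n) \<Longrightarrow> 1 + 1 / (2 * (real_of_int \<beta> + 3)) \<le> best"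
      by (auto simp: best_def)
    show ?case
    proof (rule exI[of _ V], rule exI[of _ E], rule exI[of _ s], intro conjI G allI impI, goal_cases)
      case (1 H)
      from small[OF this(1) best(1)[OF this(2)]] show ?case .
    next
      case (2 H)
      from small[OF this(1) best(4)[OF this(2)]] show ?case .
    next
      case (3 H)
      from small[OF this(1) best(2)[OF this(2)]] show ?case .
    next
      case (4 H)
      from small[OF this(1) best(3)[OF this(2)]] show ?case .
    qed
  qed (rule c_le(1))
qed

end
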